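(* Let $d\ge 2$, and let $\mu_1,\mu_2$ be Borel probability measures on $\mathbb{R}^d$ with compact supports. Assume that $\dim_{\mathrm F}^{1/2}\mu_1\le d/2$ and $\dim_{\mathrm F}^{1/2}\mu_2\le d/2$. Then $$\dim_{\mathrm H} D_x(\operatorname{supp}\mu_2)\ge\min\left\{1,\ \frac{\dim_{\mathrm F}^{1/2}\mu_1+\dim_{\mathrm F}^{1/2}\mu_2}{2}-\frac d4\right\}$$ for $\mu_1$-almost all $x$.
   Context: For $E\subseteq\mathbb{R}^d$ and $x\in\mathbb{R}^d$, $D_x(E)=\{|x-y|:y\in E\}$ is the pinned distance set; $\dim_{\mathrm H}$ is Hausdorff dimension. For a finite Borel measure $\mu$ on $\mathbb{R}^d$, $\widehat\mu(z)=\int e^{-2\pi i z\cdot x}\,d\mu(x)$. For $s\ge 0$ and $\theta\in(0,1]$ define $\mathcal{J}_{s,\theta}(\mu)=\left(\int_{\mathbb{R}^d}|\widehat\mu(z)|^{2/\theta}|z|^{s/\theta-d}\,dz\right)^{\theta}$. The Fourier spectrum of $\mu$ at $\theta$ is $\dim_{\mathrm F}^{\theta}\mu=\sup\{s\ge 0:\mathcal{J}_{s,\theta}(\mu)<\infty\}$ (with $\sup\emptyset=0$); here it is used with $\theta=1/2$. *)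

theory Defs
  imports "HOL-Probability.Probability"
begin

definition pinned_distance_set :: "'a::metric_space \<Rightarrow> 'a set \<Rightarrow> real set" where
  "pinned_distance_set x E = {dist x y | y. y \<in> E}"

definition measure_supp :: "'a::topological_space measure \<Rightarrow> 'a set" where
  "measure_supp M = {x. \<forall>U. open U \<longrightarrow> x \<in> U \<longrightarrow> 0 < emeasure M U}"


text \<open>
  The case distinction implements the conventions that the empty set has weight 0 for every
  exponent and that \<open>0\<^sup>0 = 1\<close> for nonempty sets (whereas \<open>0 powr 0 = 0\<close>), so that the
  0-dimensional Hausdorff measure is counting measure.
\<close>

definition diam_pow :: "real \<Rightarrow> 'a::metric_space set \<Rightarrow> ennreal" where
  "diam_pow s U =
     (if U = {} then 0 else if s = 0 then 1 else ennreal (diameter U powr s))"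

text \<open>
  Covering sets are required to be bounded because \<^const>\<open>diameter\<close> is real-valued and
  meaningless on unbounded sets. Finite covers are included via empty covering sets.
\<close>

definition hausdorff_premeasure :: "real \<Rightarrow> real \<Rightarrow> 'a::metric_space set \<Rightarrow> ennreal" where
  "hausdorff_premeasure s \<delta> A =
     Inf {(\<Sum>i. diam_pow s (U i)) | U :: nat \<Rightarrow> 'a set.
            A \<subseteq> (\<Union>i. U i) \<and> (\<forall>i. bounded (U i) \<and> diameter (U i) \<le> \<delta>)}"

definition hausdorff_measure :: "real \<Rightarrow> 'a::metric_space set \<Rightarrow> ennreal" where
  "hausdorff_measure s A = (SUP \<delta>\<in>{0<..}. hausdorff_premeasure s \<delta> A)"

definition hausdorff_dim :: "'a::metric_space set \<Rightarrow> ereal" where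
  "hausdorff_dim A = Inf (ereal ` {s. 0 \<le> s \<and> hausdorff_measure s A = 0})"


definition fourier_transform :: "'a::euclidean_space measure \<Rightarrow> 'a \<Rightarrow> complex" where
  "fourier_transform M z = (LINT x|M. exp (- 2 * of_real pi * \<i> * of_real (z \<bullet> x)))"

text \<open>
  The point \<open>z = 0\<close>, where \<open>0 powr _ = 0\<close>, is Lebesgue-null and does not affect the integral.
\<close>

definition fourier_energy_integral :: "real \<Rightarrow> real \<Rightarrow> 'a::euclidean_space measure \<Rightarrow> ennreal" where
  "fourier_energy_integral s \<theta> M =
     (\<integral>\<^sup>+ z. ennreal (cmod (fourier_transform M z) powr (2 / \<theta>)
                  * norm z powr (s / \<theta> - real DIM('a))) \<partial>lborel)"

definition fourier_energy :: "real \<Rightarrow> real \<Rightarrow> 'a::euclidean_space measure \<Rightarrow> ennreal" where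
  "fourier_energy s \<theta> M =
     (let I = fourier_energy_integral s \<theta> M
      in if I = \<infinity> then \<infinity> else ennreal (enn2real I powr \<theta>))"

text \<open>
  The spectrum is extended-real-valued: the supremum is \<open>\<infinity>\<close>, e.g., for measures with a smooth
  compactly supported density. In \<^typ>\<open>ereal\<close> the supremum of the empty set is \<open>- \<infinity>\<close>, hence the
  separate case.
\<close>

definition fourier_spectrum :: "real \<Rightarrow> 'a::euclidean_space measure \<Rightarrow> ereal" where
  "fourier_spectrum \<theta> M =
     (let S = {s. 0 \<le> s \<and> fourier_energy s \<theta> M < \<infinity>}
      in if S = {} then 0 else Sup (ereal ` S))"

end

theory Submission
  imports Defs
begin

text \<open>
  Write \<open>e(t) = exp (-2 \<pi> i t)\<close>, let \<open>d\<close> be the dimension, and let \<open>\<nu>\<^sub>x\<close> be the image of \<open>\<mu>\<^sub>2\<close> under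
  \<open>y \<mapsto> |x - y|\<^sup>2\<close>. Squared distances make the pinned problem linear in the pin: since
  \<open>|x - y|\<^sup>2 - |x - y'|\<^sup>2 = |y|\<^sup>2 - |y'|\<^sup>2 - 2 x \<bullet> (y - y')\<close>, integrating
  \<open>e (t (|x - y|\<^sup>2 - |x - y'|\<^sup>2))\<close> in \<open>x\<close> against \<open>\<mu>\<^sub>1\<close> produces a unimodular factor times the Fourier
  transform of \<open>\<mu>\<^sub>1\<close> at \<open>-2 t (y - y')\<close>. With the Cauchy-Schwarz inequality the mean square
  \<open>A(t)\<close> of the Fourier transform of \<open>\<nu>\<^sub>x\<close> at \<open>t\<close>, averaged over \<open>x\<close>, satisfies
  \<open>A(t)\<^sup>2 \<le> \<integral> |FT \<mu>\<^sub>1|\<^sup>2 d\<lambda>\<close>, where \<open>\<lambda>\<close> is the distribution of \<open>2 t (y - y')\<close> for independent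
  \<open>\<mu>\<^sub>2\<close>-random \<open>y\<close>, \<open>y'\<close> (\<open>mean_square_fourier_squared_distance_le\<close>).

  The right-hand side pairs two positive definite objects: \<open>|FT \<mu>\<^sub>1|\<^sup>2\<close> is the transform of the
  distribution of differences of \<open>\<mu>\<^sub>1\<close>, and \<open>\<lambda>\<close> has transform \<open>|FT \<mu>\<^sub>2 (2 t \<cdot>)|\<^sup>2 \<ge> 0\<close>. All quantities
  being nonnegative, compactness of the supports allows Gaussian factors to be inserted on both
  sides at the cost of a constant, and a second use of the Cauchy-Schwarz inequality bounds
  the square of the integral by the product of \<open>\<integral> |FT \<mu>\<^sub>1|\<^sup>4\<close> and \<open>t\<^sup>-\<^sup>d \<integral> |FT \<mu>\<^sub>2|\<^sup>4\<close>, each localised to frequencies of size at most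
  about \<open>t\<close> (\<open>fourier_pairing_bound\<close>). If \<open>s\<^sub>i \<le> d/2\<close> has finite energy at \<open>\<theta> = 1/2\<close>, the localised
  fourth moment is \<open>O (t\<^bsup>d - 2 s\<^sub>i\<^esup>)\<close>; this is where the upper bound on the spectra
  enters. Altogether \<open>A(t) = O (|t|\<^bsup>-a\<^esup>)\<close> with \<open>a = (s\<^sub>1 + s\<^sub>2)/2 - d/4\<close>
  (\<open>mean_square_fourier_decay\<close>).

  The decay of \<open>A\<close> bounds the \<open>\<mu>\<^sub>1\<close>-average of the \<open>u\<close>-dimensional energy of \<open>\<nu>\<^sub>x\<close> for every
  \<open>u < min 1 a\<close> (\<open>mean_dyadic_energy_finite\<close>), so that this energy is finite for almost every \<open>x\<close>. A set
  carrying a measure of finite \<open>u\<close>-energy has positive \<open>u\<close>-dimensional Hausdorff measure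
  (\<open>hausdorff_measure_pos_of_energy\<close>). Letting \<open>u\<close> run through the rationals below the asserted
  bound proves the theorem.
\<close>

section \<open>Fourier transforms of probability measures and Gaussian energies\<close>

locale borel_prob = prob_space M for M :: "'a::euclidean_space measure" +
  assumes sets_eq_borel [measurable_cong, simp]: "sets M = sets borel"
begin

lemma space_eq_UNIV [simp]: "space M = UNIV"
  using sets_eq_imp_space_eq[OF sets_eq_borel] by simp

end

lemma measurable_cis [measurable]: "cis \<in> borel_measurable borel"
  by (intro borel_measurable_continuous_onI continuous_intros)

lemma fourier_transform_cis:
  "fourier_transform M z = (LINT x|M. cis (-2 * pi * (z \<bullet> x)))"
  unfolding fourier_transform_def cis_conv_exp by (simp add: mult_ac)

context borel_prob
begin

lemma measurable_fourier_transform [measurable]: "fourier_transform M \<in> borel_measurable borel"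
  unfolding fourier_transform_cis by measurable

lemma cmod_fourier_transform_le_1: "cmod (fourier_transform M z) \<le> 1"
proof -
  have "cmod (fourier_transform M z) \<le> (LINT x|M. cmod (cis (-2 * pi * (z \<bullet> x))))"
    unfolding fourier_transform_cis by (rule integral_norm_bound)
  then show ?thesis using prob_space by simp
qed

lemma fourier_transform_minus: "fourier_transform M (- z) = cnj (fourier_transform M z)"
  unfolding fourier_transform_cis by (subst Bochner_Integration.integral_cnj[symmetric]) (simp add: cis_cnj)

end

text \<open>
  Fubini's theorem for the kernel \<open>e (z \<bullet> x)\<close>, which is symmetric in \<open>x\<close> and \<open>z\<close>. It takes the place
  of Parseval's identity: the functions to be paired below are transforms of finite measures.
\<close>

lemma fourier_transform_multiplication_formula:
  assumes "borel_prob M" "borel_prob N"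
  shows "(LINT z|N. fourier_transform M z) = (LINT x|M. fourier_transform N x)"
proof -
  interpret M: borel_prob M by fact
  interpret N: borel_prob N by fact
  interpret pair_prob_space N M ..
  have "integrable (N \<Otimes>\<^sub>M M) (\<lambda>(z, x). cis (-2 * pi * (z \<bullet> x)))"
    by (rule integrable_const_bound[where B = 1]) auto
  from Fubini_integral[OF this] show ?thesis
    unfolding fourier_transform_cis by (simp add: inner_commute)
qed

text \<open>
  The distribution of \<open>x - y\<close> for independent \<open>x\<close>, \<open>y\<close>; it turns the square of a modulus of a
  transform into a transform.
\<close>

definition difference_distr :: "'a::euclidean_space measure \<Rightarrow> 'a measure" where
  "difference_distr M = distr (M \<Otimes>\<^sub>M M) borel (\<lambda>(x, y). x - y)"

lemma (in borel_prob) borel_prob_difference_distr: "borel_prob (difference_distr M)"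
proof -
  interpret MM: pair_prob_space M M ..
  have "prob_space (difference_distr M)"
    unfolding difference_distr_def by (rule MM.prob_space_distr) measurable
  then show ?thesis
    by (simp add: borel_prob_def borel_prob_axioms_def difference_distr_def)
qed

lemma (in borel_prob) integral_difference_distr_iterated:
  fixes f :: "'a \<Rightarrow> 'b::{banach, second_countable_topology}"
  assumes [measurable]: "f \<in> borel_measurable borel" and "\<And>x. norm (f x) \<le> B"
  shows "(LINT z|difference_distr M. f z) = (LINT x|M. LINT y|M. f (x - y))"
proof -
  interpret MM: pair_prob_space M M ..
  have "(LINT z|difference_distr M. f z) = integral\<^sup>L (M \<Otimes>\<^sub>M M) (\<lambda>(x, y). f (x - y))"
    unfolding difference_distr_def by (subst integral_distr) (auto simp: split_beta')
  also have "\<dots> = (LINT x|M. LINT y|M. f (x - y))"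
    using MM.integral_fst'[of "\<lambda>(x, y). f (x - y)"] MM.integrable_const_bound[of "\<lambda>(x, y). f (x - y)" B] assms(2)
    by (simp add: split_beta')
  finally show ?thesis .
qed

lemma (in borel_prob) nn_integral_difference_distr:
  assumes [measurable]: "f \<in> borel_measurable borel"
  shows "(\<integral>\<^sup>+z. f z \<partial>difference_distr M) = (\<integral>\<^sup>+x. \<integral>\<^sup>+y. f (x - y) \<partial>M \<partial>M)"
proof -
  interpret MM: pair_prob_space M M ..
  have "(\<integral>\<^sup>+z. f z \<partial>difference_distr M) = (\<integral>\<^sup>+(x, y). f (x - y) \<partial>(M \<Otimes>\<^sub>M M))"
    unfolding difference_distr_def by (subst nn_integral_distr) (auto simp: split_beta')
  also have "\<dots> = (\<integral>\<^sup>+x. \<integral>\<^sup>+y. f (x - y) \<partial>M \<partial>M)"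
    using nn_integral_fst[of "\<lambda>(x, y). f (x - y)" M] by simp
  finally show ?thesis .
qed

lemma (in borel_prob) fourier_transform_difference_distr:
  "fourier_transform (difference_distr M) z = (cmod (fourier_transform M z))\<^sup>2"
proof -
  have "fourier_transform (difference_distr M) z
      = (LINT x|M. LINT y|M. cis (-2 * pi * (z \<bullet> (x - y))))"
    unfolding fourier_transform_cis by (rule integral_difference_distr_iterated[where B = 1]) auto
  also have "\<dots> = (LINT x|M. LINT y|M. cis (-2 * pi * (z \<bullet> x)) * cnj (cis (-2 * pi * (z \<bullet> y))))"
    by (simp add: cis_mult cis_cnj inner_diff_right right_diff_distrib)
  also have "\<dots> = fourier_transform M z * cnj (fourier_transform M z)"
    unfolding fourier_transform_cis by simp
  finally show ?thesis unfolding complex_norm_square .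
qed

text \<open>
  Normalised so that the total mass is \<open>1\<close> and the Fourier transform is \<open>exp (- \<pi> |p|\<^sup>2 / r\<^sup>2)\<close>; the
  parameter \<open>r\<close> is an inverse width.
\<close>

definition gauss_density :: "real \<Rightarrow> 'a::euclidean_space \<Rightarrow> real" where
  "gauss_density r z = r ^ DIM('a) * exp (- pi * r\<^sup>2 * (norm z)\<^sup>2)"

lemma gauss_density_pos: "r > 0 \<Longrightarrow> gauss_density r z > 0"
  by (simp add: gauss_density_def)

lemma measurable_gauss_density [measurable]: "gauss_density r \<in> borel_measurable borel"
  unfolding gauss_density_def by measurable

lemma norm_sq_eq_sum_Basis: "(norm z)\<^sup>2 = (\<Sum>b\<in>Basis. (z \<bullet> b)\<^sup>2)"
  unfolding power2_norm_eq_inner by (subst euclidean_inner) (simp add: power2_eq_square)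

lemma gauss_density_prod:
  fixes z :: "'a::euclidean_space"
  shows "gauss_density r z = (\<Prod>b\<in>Basis. gauss_density r (z \<bullet> b))"
proof -
  have "(norm z)\<^sup>2 = (\<Sum>b\<in>Basis. (z \<bullet> b)\<^sup>2)"
    by (rule norm_sq_eq_sum_Basis)
  then show ?thesis
    unfolding gauss_density_def
    by (simp add: prod.distrib exp_sum sum_distrib_left)
qed

lemma gauss_density_eq_normal_density:
  fixes x :: real
  assumes "r > 0"
  shows "gauss_density r x = normal_density 0 (1 / (r * sqrt (2 * pi))) x"
  using assms by (simp add: gauss_density_def normal_density_def power_divide power_mult_distrib
      real_sqrt_mult real_sqrt_divide field_simps)

lemma integral_lborel_prod:
  fixes f :: "'a::euclidean_space \<Rightarrow> real \<Rightarrow> 'b::{real_normed_field, banach, second_countable_topology}"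
  assumes [measurable]: "\<And>b. b \<in> Basis \<Longrightarrow> integrable lborel (f b)"
  shows "(LINT x|lborel. (\<Prod>b\<in>Basis. f b (x \<bullet> b))) = (\<Prod>b\<in>Basis. LINT x|lborel. f b x)"
proof -
  interpret product_sigma_finite "\<lambda>b::'a. lborel :: real measure" ..
  have meas [measurable]: "f b \<in> borel_measurable borel" if "b \<in> Basis" for b
    using assms[OF that] by (auto dest: borel_measurable_integrable)
  have "(LINT x|lborel. (\<Prod>b\<in>Basis. f b (x \<bullet> b)))
      = (LINT g|(\<Pi>\<^sub>M b\<in>Basis. lborel). (\<Prod>b\<in>Basis. f b ((\<Sum>c\<in>Basis. g c *\<^sub>R c) \<bullet> b)))"
    by (subst lborel_eq, subst integral_distr) auto
  also have "\<dots> = (LINT g|(\<Pi>\<^sub>M b\<in>Basis. lborel). (\<Prod>b\<in>Basis. f b (g b)))"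
    by (simp cong: prod.cong)
  also have "\<dots> = (\<Prod>b\<in>Basis. LINT x|lborel. f b x)"
    by (rule product_integral_prod) (use assms in auto)
  finally show ?thesis .
qed

text \<open>
  The characteristic function of the standard normal distribution after the substitution
  \<open>x \<mapsto> r \<surd>(2\<pi>) x\<close>.
\<close>

lemma fourier_integral_gauss_density_real:
  fixes p :: real
  assumes "r > 0"
  shows "integrable lborel (\<lambda>x::real. gauss_density r x * cis (-2 * pi * (p * x)))"
    and "(LINT x|lborel. gauss_density r (x::real) * cis (-2 * pi * (p * x)))
       = exp (- pi * p\<^sup>2 / r\<^sup>2)"
proof -
  let ?\<sigma> = "1 / (r * sqrt (2 * pi))"
  have int: "integrable lborel (\<lambda>x::real. gauss_density r x)"
    using integrable_normal_density[of ?\<sigma> 0] assms by (simp add: gauss_density_eq_normal_density)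
  show "integrable lborel (\<lambda>x::real. gauss_density r x * cis (-2 * pi * (p * x)))"
    by (rule Bochner_Integration.integrable_bound[OF int]) (auto simp: norm_mult)
  have "complex_of_real (exp (- ((- 2 * pi * p * ?\<sigma>)\<^sup>2) / 2))
      = (CLINT x|density lborel std_normal_density. iexp ((- 2 * pi * p * ?\<sigma>) * x))"
    by (simp only: char_std_normal_distribution flip: char_def)
  also have "\<dots> = (LINT x|lborel. std_normal_density x *\<^sub>R cis (- 2 * pi * p * ?\<sigma> * x))"
    by (subst integral_density) (auto simp: cis_conv_exp)
  also have "\<dots> = \<bar>1/?\<sigma>\<bar> *\<^sub>R (LINT x|lborel. std_normal_density ((1/?\<sigma>) * x) *\<^sub>R cis (- 2 * pi * p * ?\<sigma> * ((1/?\<sigma>) * x)))"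
    using assms by (subst lborel_integral_real_affine[where c = "1/?\<sigma>" and t = 0]) auto
  also have "\<dots> = (LINT x|lborel. gauss_density r x * cis (-2 * pi * (p * x)))"
    unfolding Bochner_Integration.integral_scaleR_right[symmetric] using assms
    by (intro Bochner_Integration.integral_cong)
      (auto simp: gauss_density_def std_normal_density_def scaleR_conv_of_real real_sqrt_mult power_mult_distrib field_simps)
  finally show "(LINT x|lborel. gauss_density r (x::real) * cis (-2 * pi * (p * x)))
       = exp (- pi * p\<^sup>2 / r\<^sup>2)"
    using assms by (simp add: power_mult_distrib power_divide) (simp add: field_simps power2_eq_square)
qed

lemma cis_sum: "cis (\<Sum>i\<in>I. f i) = (\<Prod>i\<in>I. cis (f i))"
  by (induction I rule: infinite_finite_induct) (auto simp flip: cis_mult)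

lemma fourier_integral_gauss_density:
  fixes p :: "'a::euclidean_space"
  assumes "r > 0"
  shows "(LINT x|lborel. gauss_density r x * cis (-2 * pi * (p \<bullet> x)))
       = exp (- pi * (norm p)\<^sup>2 / r\<^sup>2)"
proof -
  have "(LINT x|lborel. gauss_density r x * cis (-2 * pi * (p \<bullet> x)))
      = (LINT x|lborel. (\<Prod>b\<in>Basis. gauss_density r (x \<bullet> b) * cis (-2 * pi * ((p \<bullet> b) * (x \<bullet> b)))))"
  proof -
    have "gauss_density r x * cis (-2 * pi * (p \<bullet> x))
        = (\<Prod>b\<in>Basis. gauss_density r (x \<bullet> b) * cis (-2 * pi * ((p \<bullet> b) * (x \<bullet> b))))" for x
      unfolding gauss_density_prod[of r x] euclidean_inner[of p x] sum_distrib_left cis_sum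
        of_real_prod prod.distrib ..
    then show ?thesis by (simp only:)
  qed
  also have "\<dots> = (\<Prod>b\<in>Basis. exp (- pi * (p \<bullet> b)\<^sup>2 / r\<^sup>2))"
    by (subst integral_lborel_prod)
      (simp_all only: fourier_integral_gauss_density_real[OF assms] of_real_prod)
  also have "\<dots> = exp (- pi * (norm p)\<^sup>2 / r\<^sup>2)"
  proof -
    have "(norm p)\<^sup>2 = (\<Sum>b\<in>Basis. (p \<bullet> b)\<^sup>2)"
      by (rule norm_sq_eq_sum_Basis)
    then show ?thesis
      by (simp add: sum_distrib_left sum_divide_distrib flip: exp_sum)
  qed
  finally show ?thesis .
qed

definition gauss_measure :: "real \<Rightarrow> 'a::euclidean_space measure" where
  "gauss_measure r = density lborel (\<lambda>z. ennreal (gauss_density r z))"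

lemma borel_prob_gauss_measure:
  assumes "r > 0"
  shows "borel_prob (gauss_measure r :: 'a::euclidean_space measure)"
proof -
  have "(\<integral>\<^sup>+z. ennreal (gauss_density r (z::'a)) \<partial>lborel)
      = (\<integral>\<^sup>+z. (\<Prod>b\<in>Basis. ennreal (gauss_density r ((z::'a) \<bullet> b))) \<partial>lborel)"
    by (simp add: gauss_density_prod[of r "_::'a"] prod_ennreal gauss_density_pos[OF assms] less_imp_le)
  also have "\<dots> = (\<Prod>b\<in>(Basis::'a set). (\<integral>\<^sup>+x. ennreal (gauss_density r (x::real)) \<partial>lborel))"
    by (rule nn_integral_lborel_prod) auto
  also have "(\<integral>\<^sup>+x. ennreal (gauss_density r (x::real)) \<partial>lborel) = 1"
  proof -
    interpret prob_space "density lborel (normal_density 0 (1 / (r * sqrt (2 * pi))))"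
      using assms by (intro prob_space_normal_density) auto
    show ?thesis
      using emeasure_space_1 assms by (simp add: emeasure_density gauss_density_eq_normal_density)
  qed
  finally have "emeasure (gauss_measure r :: 'a measure) UNIV = 1"
    by (simp add: gauss_measure_def emeasure_density)
  then show ?thesis
    by (auto simp: borel_prob_def borel_prob_axioms_def gauss_measure_def intro!: prob_spaceI)
qed

lemma fourier_transform_gauss_measure:
  fixes p :: "'a::euclidean_space"
  assumes "r > 0"
  shows "fourier_transform (gauss_measure r) p = exp (- pi * (norm p)\<^sup>2 / r\<^sup>2)"
  unfolding fourier_transform_cis gauss_measure_def
  using assms fourier_integral_gauss_density[of r p]
  by (subst integral_density) (auto simp: gauss_density_pos less_imp_le scaleR_conv_of_real)

text \<open>
  The multiplication formula for the distribution of differences and a Gaussian: pairs of points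
  at distance at most about \<open>r\<close> are counted by an average of \<open>|FT M|\<^sup>2\<close> over frequencies up to about
  \<open>1/r\<close>.
\<close>

lemma (in borel_prob) gauss_energy_eq:
  assumes "r > 0"
  shows "(\<integral>\<^sup>+x. \<integral>\<^sup>+y. ennreal (exp (- pi * (norm (x - y))\<^sup>2 / r\<^sup>2)) \<partial>M \<partial>M)
       = (\<integral>\<^sup>+z. ennreal (gauss_density r z * (cmod (fourier_transform M z))\<^sup>2) \<partial>lborel)"
proof -
  interpret G: borel_prob "gauss_measure r :: 'a measure"
    by (rule borel_prob_gauss_measure) fact
  interpret D: borel_prob "difference_distr M"
    by (rule borel_prob_difference_distr)
  have "(LINT x|difference_distr M. complex_of_real (exp (- pi * (norm x)\<^sup>2 / r\<^sup>2)))
      = (LINT z|gauss_measure r. complex_of_real ((cmod (fourier_transform M z))\<^sup>2))"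
    using fourier_transform_multiplication_formula[OF D.borel_prob_axioms G.borel_prob_axioms]
    by (simp add: fourier_transform_difference_distr fourier_transform_gauss_measure assms)
  then have eq: "(LINT x|difference_distr M. exp (- pi * (norm x)\<^sup>2 / r\<^sup>2))
      = (LINT z|gauss_measure r. (cmod (fourier_transform M z))\<^sup>2)"
    unfolding integral_complex_of_real of_real_eq_iff .
  have "(\<integral>\<^sup>+x. \<integral>\<^sup>+y. ennreal (exp (- pi * (norm (x - y))\<^sup>2 / r\<^sup>2)) \<partial>M \<partial>M)
      = (\<integral>\<^sup>+z. ennreal (exp (- pi * (norm z)\<^sup>2 / r\<^sup>2)) \<partial>difference_distr M)"
    by (subst nn_integral_difference_distr) auto
  also have "\<dots> = ennreal (LINT x|difference_distr M. exp (- pi * (norm x)\<^sup>2 / r\<^sup>2))"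
    by (rule nn_integral_eq_integral)
       (auto intro!: D.integrable_const_bound[where B = 1])
  also have "\<dots> = (\<integral>\<^sup>+z. ennreal ((cmod (fourier_transform M z))\<^sup>2) \<partial>gauss_measure r)"
    unfolding eq by (rule nn_integral_eq_integral[symmetric])
       (auto intro!: G.integrable_const_bound[where B = 1] AE_I2 simp: power_le_one cmod_fourier_transform_le_1)
  also have "\<dots> = (\<integral>\<^sup>+z. ennreal (gauss_density r z * (cmod (fourier_transform M z))\<^sup>2) \<partial>lborel)"
    unfolding gauss_measure_def using assms
    by (subst nn_integral_density) (auto simp: ennreal_mult' gauss_density_pos less_imp_le)
  finally show ?thesis .
qed

section \<open>Gaussian truncation and smoothing\<close>

lemma nn_integral_lborel_scale:
  fixes f :: "'a::euclidean_space \<Rightarrow> ennreal"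
  assumes [measurable]: "f \<in> borel_measurable borel" and "c > 0"
  shows "(\<integral>\<^sup>+z. f z \<partial>lborel) = ennreal (c ^ DIM('a)) * (\<integral>\<^sup>+z. f (c *\<^sub>R z) \<partial>lborel)"
proof -
  have "(\<integral>\<^sup>+z. f z \<partial>lborel)
      = (\<integral>\<^sup>+z. f z \<partial>density (distr lborel borel (\<lambda>x::'a. 0 + c *\<^sub>R x)) (\<lambda>_. \<bar>c\<bar>^DIM('a)))"
    using lborel_affine[of c "0::'a"] assms by simp
  also have "\<dots> = ennreal (c ^ DIM('a)) * (\<integral>\<^sup>+z. f (c *\<^sub>R z) \<partial>lborel)"
    using assms(2) by (simp add: nn_integral_density nn_integral_distr nn_integral_cmult)
  finally show ?thesis .
qed

lemma nn_integral_lborel_translate: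
  fixes f :: "'a::euclidean_space \<Rightarrow> ennreal"
  assumes [measurable]: "f \<in> borel_measurable borel"
  shows "(\<integral>\<^sup>+z. f (a + z) \<partial>lborel) = (\<integral>\<^sup>+z. f z \<partial>lborel)"
proof -
  have "(\<integral>\<^sup>+z. f z \<partial>lborel) = (\<integral>\<^sup>+z. f z \<partial>distr lborel borel (\<lambda>z. a + z))"
    by (simp add: lborel_distr_plus)
  also have "\<dots> = (\<integral>\<^sup>+z. f (a + z) \<partial>lborel)"
    by (simp add: nn_integral_distr)
  finally show ?thesis ..
qed

text \<open>
  A single term of the exponential series of \<open>exp (c x\<^sup>2)\<close> already dominates \<open>x powr b\<close>.
\<close>

lemma powr_times_gaussian_bounded:
  fixes b c :: real
  assumes "b \<ge> 0" "c > 0"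
  obtains C where "C > 0" "\<And>x. x > 0 \<Longrightarrow> x powr b * exp (- c * x\<^sup>2) \<le> C"
proof
  define n where "n = nat \<lceil>b\<rceil>"
  have n: "real n \<ge> b" unfolding n_def by linarith
  let ?C = "1 + fact n / c ^ n"
  show "?C > 0" using assms by (simp add: add_pos_pos)
  fix x :: real assume "x > 0"
  show "x powr b * exp (- c * x\<^sup>2) \<le> ?C"
  proof (cases "x \<le> 1")
    case True
    have "x powr b * exp (- c * x\<^sup>2) \<le> 1 * 1"
      using True \<open>x > 0\<close> assms by (intro mult_mono powr_le1) auto
    also have "\<dots> \<le> ?C" using assms by simp
    finally show ?thesis .
  next
    case False
    have "x powr b \<le> x powr (2 * real n)" using False n assms by (intro powr_mono) auto
    also have "\<dots> = x powr real (2 * n)" by simp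
    also have "\<dots> = (x\<^sup>2) ^ n" unfolding power_mult[symmetric] using \<open>x > 0\<close> by (rule powr_realpow)
    also have "\<dots> = fact n / c ^ n * ((c * x\<^sup>2) ^ n / fact n)"
      using assms by (simp add: power_mult_distrib)
    also have "\<dots> \<le> fact n / c ^ n * exp (c * x\<^sup>2)"
    proof (intro mult_left_mono)
      have "(c * x\<^sup>2) ^ n / fact n = (\<Sum>k\<in>{n}. (c * x\<^sup>2) ^ k /\<^sub>R fact k)" by (simp add: divide_inverse)
      also have "\<dots> \<le> (\<Sum>k. (c * x\<^sup>2) ^ k /\<^sub>R fact k)"
        using assms by (intro sum_le_suminf summable_exp_generic) auto
      finally show "(c * x\<^sup>2) ^ n / fact n \<le> exp (c * x\<^sup>2)" by (simp add: exp_def)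
    qed (use assms in auto)
    finally have "x powr b * exp (- c * x\<^sup>2) \<le> fact n / c ^ n * exp (c * x\<^sup>2) * exp (- c * x\<^sup>2)"
      by (intro mult_right_mono) auto
    also have "\<dots> = fact n / c ^ n" by (simp add: exp_minus)
    finally show ?thesis by simp
  qed
qed

text \<open>
  A Gaussian cutoff at scale \<open>t\<close> is at most a constant times \<open>(|v| / t) powr (-b)\<close> when \<open>b \<ge> 0\<close>, so
  a weighted integral with weight \<open>|v| powr (-b)\<close> controls the truncated one with a factor \<open>t powr b\<close>.
  With \<open>b = d - 2 s\<close> the sign condition is the requirement \<open>s \<le> d/2\<close>.
\<close>

lemma nn_integral_gaussian_cutoff_le:
  fixes b c :: real
  assumes "b \<ge> 0" "c > 0"
  obtains C where "C > 0"
    "\<And>t (f :: 'a::euclidean_space \<Rightarrow> real). t > 0 \<Longrightarrow> f \<in> borel_measurable borel \<Longrightarrow> (\<And>v. f v \<ge> 0) \<Longrightarrow>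
       (\<integral>\<^sup>+v. ennreal (f v * exp (- c * (norm v / t)\<^sup>2)) \<partial>lborel)
         \<le> ennreal (C * t powr b) * (\<integral>\<^sup>+v. ennreal (f v * norm v powr (- b)) \<partial>lborel)"
proof -
  obtain C where C: "C > 0" "\<And>x. x > 0 \<Longrightarrow> x powr b * exp (- c * x\<^sup>2) \<le> C"
    using powr_times_gaussian_bounded[OF assms] by blast
  show thesis
  proof (rule that[OF \<open>C > 0\<close>])
    fix t :: real and f :: "'a \<Rightarrow> real"
    assume t: "t > 0" and [measurable]: "f \<in> borel_measurable borel" and f: "\<And>v. f v \<ge> 0"
    have "exp (- c * (norm v / t)\<^sup>2) \<le> C * t powr b * norm v powr (- b)" if "v \<noteq> 0" for v :: 'a
    proof -
      have "(norm v / t) powr b * exp (- c * (norm v / t)\<^sup>2) \<le> C"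
        using that t by (intro C(2)) auto
      moreover have "(norm v / t) powr b = norm v powr b / t powr b"
        using that t by (simp add: powr_divide)
      ultimately show ?thesis
        using that t by (simp add: powr_minus field_simps)
    qed
    then have "f v * exp (- c * (norm v / t)\<^sup>2) \<le> C * t powr b * (f v * norm v powr (- b))"
      if "v \<noteq> 0" for v
      using mult_left_mono[OF _ f, of "exp (- c * (norm v / t)\<^sup>2)" "C * t powr b * norm v powr (- b)" v] that
      by (simp add: mult_ac)
    then have "ennreal (f v * exp (- c * (norm v / t)\<^sup>2))
        \<le> ennreal (C * t powr b) * ennreal (f v * norm v powr (- b))" if "v \<noteq> 0" for v
      using that C(1) f by (subst ennreal_mult[symmetric]) (auto intro!: ennreal_leI)
    then have "AE v::'a in lborel. ennreal (f v * exp (- c * (norm v / t)\<^sup>2))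
        \<le> ennreal (C * t powr b) * ennreal (f v * norm v powr (- b))"
      using AE_lborel_singleton[of "0::'a"] by (rule eventually_mono[rotated])
    then have "(\<integral>\<^sup>+v. ennreal (f v * exp (- c * (norm v / t)\<^sup>2)) \<partial>lborel)
        \<le> (\<integral>\<^sup>+v. ennreal (C * t powr b) * ennreal (f v * norm v powr (- b)) \<partial>lborel)"
      by (rule nn_integral_mono_AE)
    then show "(\<integral>\<^sup>+v. ennreal (f v * exp (- c * (norm v / t)\<^sup>2)) \<partial>lborel)
         \<le> ennreal (C * t powr b) * (\<integral>\<^sup>+v. ennreal (f v * norm v powr (- b)) \<partial>lborel)"
      by (simp add: nn_integral_cmult)
  qed
qed

definition gauss_convolution :: "'a::euclidean_space measure \<Rightarrow> 'a measure" where
  "gauss_convolution M = distr (M \<Otimes>\<^sub>M gauss_measure 1) borel (\<lambda>(w, v). w + v)"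

context borel_prob
begin

lemma borel_prob_gauss_convolution: "borel_prob (gauss_convolution M)"
proof -
  interpret G: borel_prob "gauss_measure 1 :: 'a measure" by (rule borel_prob_gauss_measure) simp
  interpret MG: pair_prob_space M "gauss_measure 1 :: 'a measure" ..
  have "prob_space (gauss_convolution M)"
    unfolding gauss_convolution_def by (rule MG.prob_space_distr) measurable
  then show ?thesis
    by (simp add: borel_prob_def borel_prob_axioms_def gauss_convolution_def)
qed

lemma fourier_transform_gauss_convolution:
  "fourier_transform (gauss_convolution M) z = fourier_transform M z * exp (- pi * (norm z)\<^sup>2)"
proof -
  interpret G: borel_prob "gauss_measure 1 :: 'a measure" by (rule borel_prob_gauss_measure) simp
  interpret MG: pair_prob_space M "gauss_measure 1 :: 'a measure" ..
  let ?f = "\<lambda>(w, v). cis (-2 * pi * (z \<bullet> w)) * cis (-2 * pi * (z \<bullet> v))"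
  have [measurable]: "?f \<in> borel_measurable (M \<Otimes>\<^sub>M gauss_measure 1)" by measurable
  have "fourier_transform (gauss_convolution M) z
      = integral\<^sup>L (M \<Otimes>\<^sub>M gauss_measure 1) (\<lambda>(w, v). cis (-2 * pi * (z \<bullet> (w + v))))"
    unfolding gauss_convolution_def fourier_transform_cis
    by (subst integral_distr) (auto simp: split_beta')
  also have "\<dots> = integral\<^sup>L (M \<Otimes>\<^sub>M gauss_measure 1) ?f"
    by (intro Bochner_Integration.integral_cong) (auto simp: cis_mult inner_add_right algebra_simps)
  also have "\<dots> = (LINT w|M. LINT v|gauss_measure 1. cis (-2 * pi * (z \<bullet> w)) * cis (-2 * pi * (z \<bullet> v)))"
    using MG.integral_fst'[of ?f] MG.integrable_const_bound[of ?f 1]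
    by (simp add: split_beta' norm_mult)
  also have "\<dots> = fourier_transform M z * fourier_transform (gauss_measure 1) z"
    unfolding fourier_transform_cis by simp
  finally show ?thesis by (simp add: fourier_transform_gauss_measure)
qed

lemma nn_integral_gauss_convolution:
  assumes [measurable]: "f \<in> borel_measurable borel"
  shows "(\<integral>\<^sup>+v. f v \<partial>gauss_convolution M)
       = (\<integral>\<^sup>+v. f v * (\<integral>\<^sup>+w. ennreal (exp (- pi * (norm (v - w))\<^sup>2)) \<partial>M) \<partial>lborel)"
proof -
  interpret G: borel_prob "gauss_measure 1 :: 'a measure" by (rule borel_prob_gauss_measure) simp
  interpret MV: pair_sigma_finite M "lborel :: 'a measure" ..
  have "(\<integral>\<^sup>+v. f v \<partial>gauss_convolution M) = (\<integral>\<^sup>+(w, v). f (w + v) \<partial>(M \<Otimes>\<^sub>M gauss_measure 1))"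
    unfolding gauss_convolution_def by (subst nn_integral_distr) (auto simp: split_beta')
  also have "\<dots> = (\<integral>\<^sup>+w. \<integral>\<^sup>+v. f (w + v) \<partial>gauss_measure 1 \<partial>M)"
    using G.nn_integral_fst[of "\<lambda>(w, v). f (w + v)" M] by simp
  also have "\<dots> = (\<integral>\<^sup>+w. \<integral>\<^sup>+v. f v * ennreal (exp (- pi * (norm (v - w))\<^sup>2)) \<partial>lborel \<partial>M)"
  proof (rule nn_integral_cong)
    fix w
    have "(\<integral>\<^sup>+v. f (w + v) \<partial>gauss_measure 1)
        = (\<integral>\<^sup>+v. f (w + v) * ennreal (exp (- pi * (norm ((w + v) - w))\<^sup>2)) \<partial>lborel)"
      unfolding gauss_measure_def by (subst nn_integral_density) (auto simp: gauss_density_def mult_ac)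
    also have "\<dots> = (\<integral>\<^sup>+v. f v * ennreal (exp (- pi * (norm (v - w))\<^sup>2)) \<partial>lborel)"
      by (rule nn_integral_lborel_translate[where f = "\<lambda>v. f v * ennreal (exp (- pi * (norm (v - w))\<^sup>2))"]) measurable
    finally show "(\<integral>\<^sup>+v. f (w + v) \<partial>gauss_measure 1)
      = (\<integral>\<^sup>+v. f v * ennreal (exp (- pi * (norm (v - w))\<^sup>2)) \<partial>lborel)" .
  qed
  also have "\<dots> = (\<integral>\<^sup>+v. \<integral>\<^sup>+w. f v * ennreal (exp (- pi * (norm (v - w))\<^sup>2)) \<partial>M \<partial>lborel)"
    using MV.Fubini'[of "\<lambda>w v. f v * ennreal (exp (- pi * (norm (v - w))\<^sup>2))"] by simp
  also have "\<dots> = (\<integral>\<^sup>+v. f v * (\<integral>\<^sup>+w. ennreal (exp (- pi * (norm (v - w))\<^sup>2)) \<partial>M) \<partial>lborel)"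
    by (simp add: nn_integral_cmult)
  finally show ?thesis .
qed

text \<open>
  By the parallelogram law, the product of the Gaussians centred at \<open>w\<close> and \<open>w'\<close> is a Gaussian
  centred at the midpoint times a Gaussian in \<open>w - w'\<close>. Integrating out \<open>v\<close> leaves a Gaussian
  energy of \<open>M\<close>.
\<close>

lemma nn_integral_gauss_smoothing_square:
  "(\<integral>\<^sup>+v. (\<integral>\<^sup>+w. ennreal (exp (- (pi / 2) * (norm (v - w))\<^sup>2)) \<partial>M)\<^sup>2 \<partial>lborel)
     = (\<integral>\<^sup>+z. ennreal (gauss_density 2 z * (cmod (fourier_transform M z))\<^sup>2) \<partial>lborel)"
proof -
  interpret G: borel_prob "gauss_measure 1 :: 'a measure" by (rule borel_prob_gauss_measure) simp
  interpret MV: pair_sigma_finite M "lborel :: 'a measure" ..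
  let ?h = "\<lambda>v w. exp (- (pi / 2) * (norm (v - w))\<^sup>2)"
  have split: "?h v w * ?h v w' = exp (- pi * (norm (w - w'))\<^sup>2 / 2\<^sup>2) * gauss_density 1 (v - (1/2) *\<^sub>R (w + w'))"
    for v w w' :: 'a
  proof -
    let ?m = "(1/2) *\<^sub>R (w + w')"
    have "(norm ((v - w) + (v - w')))\<^sup>2 + (norm ((v - w) - (v - w')))\<^sup>2
        = 2 * (norm (v - w))\<^sup>2 + 2 * (norm (v - w'))\<^sup>2"
      unfolding power2_norm_eq_inner by (simp add: algebra_simps inner_commute)
    moreover have "(v - w) + (v - w') = 2 *\<^sub>R (v - ?m)"
      by (simp add: algebra_simps scaleR_2)
    moreover have "(v - w) - (v - w') = - (w - w')"
      by simp
    ultimately have "(norm (v - w))\<^sup>2 + (norm (v - w'))\<^sup>2 = 2 * (norm (v - ?m))\<^sup>2 + (norm (w - w'))\<^sup>2 / 2"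
      by (simp only: norm_scaleR norm_minus_cancel) (simp add: power_mult_distrib)
    then have "- (pi / 2) * ((norm (v - w))\<^sup>2 + (norm (v - w'))\<^sup>2)
        = - (pi / 2) * (2 * (norm (v - ?m))\<^sup>2 + (norm (w - w'))\<^sup>2 / 2)"
      by (rule arg_cong)
    then show ?thesis
      by (simp add: gauss_density_def algebra_simps flip: exp_add)
  qed
  have mass: "(\<integral>\<^sup>+v. ennreal (gauss_density 1 (v - a)) \<partial>lborel) = 1" for a :: 'a
    using G.emeasure_space_1
    using nn_integral_lborel_translate[of "\<lambda>v. ennreal (gauss_density 1 v)" "- a"]
    by (simp add: gauss_measure_def emeasure_density)
  have "(\<integral>\<^sup>+v. (\<integral>\<^sup>+w. ennreal (?h v w) \<partial>M)\<^sup>2 \<partial>lborel)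
      = (\<integral>\<^sup>+v. \<integral>\<^sup>+w. \<integral>\<^sup>+w'. ennreal (?h v w * ?h v w') \<partial>M \<partial>M \<partial>lborel)"
    by (simp add: power2_eq_square nn_integral_cmult nn_integral_multc ennreal_mult)
  also have "\<dots> = (\<integral>\<^sup>+w. \<integral>\<^sup>+v. \<integral>\<^sup>+w'. ennreal (?h v w * ?h v w') \<partial>M \<partial>lborel \<partial>M)"
    by (rule MV.Fubini') measurable
  also have "\<dots> = (\<integral>\<^sup>+w. \<integral>\<^sup>+w'. \<integral>\<^sup>+v. ennreal (?h v w * ?h v w') \<partial>lborel \<partial>M \<partial>M)"
    by (intro nn_integral_cong MV.Fubini') measurable
  also have "\<dots> = (\<integral>\<^sup>+w. \<integral>\<^sup>+w'. ennreal (exp (- pi * (norm (w - w'))\<^sup>2 / 2\<^sup>2)) \<partial>M \<partial>M)"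
    unfolding split by (simp add: ennreal_mult' nn_integral_cmult mass)
  also have "\<dots> = (\<integral>\<^sup>+z. ennreal (gauss_density 2 z * (cmod (fourier_transform M z))\<^sup>2) \<partial>lborel)"
    by (rule gauss_energy_eq) simp
  finally show ?thesis .
qed

end

section \<open>The mean square of the pinned Fourier transforms\<close>

lemma (in borel_prob) AE_difference_distr_norm_le:
  assumes "AE x in M. norm x \<le> R"
  shows "AE z in difference_distr M. norm z \<le> 2 * R"
proof -
  interpret MM: pair_prob_space M M ..
  have "AE x in M. AE y in M. norm (x - y) \<le> 2 * R"
    using assms
  proof eventually_elim
    case (elim x)
    show ?case
      using assms
    proof eventually_elim
      case (elim y)
      then show ?case using norm_triangle_ineq4[of x y] \<open>norm x \<le> R\<close> by linarith
    qed
  qed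
  then have "AE p in M \<Otimes>\<^sub>M M. norm (fst p - snd p) \<le> 2 * R"
  proof (intro MM.AE_pair_measure)
    show "{p \<in> space (M \<Otimes>\<^sub>M M). norm (fst p - snd p) \<le> 2 * R} \<in> sets (M \<Otimes>\<^sub>M M)"
      by measurable
  qed simp
  then show ?thesis
    unfolding difference_distr_def by (subst AE_distr_iff) (auto simp: split_beta')
qed

lemma integral_fourier_difference_distr_commute:
  assumes "borel_prob P" "borel_prob Q"
  shows "(\<integral>\<^sup>+w. ennreal ((cmod (fourier_transform P w))\<^sup>2) \<partial>Q)
       = ennreal (Re (LINT x|difference_distr P. fourier_transform Q x))"
proof -
  interpret P: borel_prob P by fact
  interpret Q: borel_prob Q by fact
  have "(LINT x|difference_distr P. fourier_transform Q x)
      = complex_of_real (LINT w|Q. (cmod (fourier_transform P w))\<^sup>2)"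
    using fourier_transform_multiplication_formula[OF P.borel_prob_difference_distr assms(2)]
    by (simp add: P.fourier_transform_difference_distr flip: of_real_power)
  moreover have "(\<integral>\<^sup>+w. ennreal ((cmod (fourier_transform P w))\<^sup>2) \<partial>Q)
      = ennreal (LINT w|Q. (cmod (fourier_transform P w))\<^sup>2)"
    by (rule nn_integral_eq_integral)
       (auto intro!: Q.integrable_const_bound[where B = 1] AE_I2
          simp: power_le_one P.cmod_fourier_transform_le_1)
  ultimately show ?thesis by simp
qed

text \<open>
  The left side is the integral of \<open>|FT Q|\<^sup>2\<close> against the differences of \<open>P\<close>. As \<open>|FT Q|\<^sup>2 \<ge> 0\<close> and
  these differences are bounded, multiplying the integrand by \<open>exp (- \<pi> |p|\<^sup>2)\<close> loses only a constant,
  and on the other side of the multiplication formula this factor is a convolution with a Gaussian.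
\<close>

lemma fourier_square_integral_le_smoothed:
  assumes "borel_prob P" "borel_prob Q" and R: "AE x in P. norm x \<le> R"
  shows "(\<integral>\<^sup>+w. ennreal ((cmod (fourier_transform P w))\<^sup>2) \<partial>difference_distr Q)
       \<le> ennreal (exp (4 * pi * R\<^sup>2))
          * (\<integral>\<^sup>+w. ennreal ((cmod (fourier_transform P w))\<^sup>2) \<partial>gauss_convolution (difference_distr Q))"
proof -
  interpret P: borel_prob P by fact
  interpret Q: borel_prob Q by fact
  interpret DP: borel_prob "difference_distr P" by (rule P.borel_prob_difference_distr)
  interpret DQ: borel_prob "difference_distr Q" by (rule Q.borel_prob_difference_distr)
  let ?q = "\<lambda>p. (cmod (fourier_transform Q p))\<^sup>2"
  have q: "0 \<le> ?q p" "?q p \<le> 1" for p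
    by (auto simp: power_le_one Q.cmod_fourier_transform_le_1)
  have FT_DQ: "fourier_transform (difference_distr Q) = (\<lambda>p. complex_of_real (?q p))"
    by (auto simp: Q.fourier_transform_difference_distr)
  have FT_DQ_gauss: "fourier_transform (gauss_convolution (difference_distr Q))
      = (\<lambda>p. complex_of_real (?q p * exp (- pi * (norm p)\<^sup>2)))"
    by (auto simp: DQ.fourier_transform_gauss_convolution Q.fourier_transform_difference_distr)
  have int: "integrable (difference_distr P) ?q"
    "integrable (difference_distr P) (\<lambda>p. ?q p * exp (- pi * (norm p)\<^sup>2))"
    using q by (auto intro!: DP.integrable_const_bound[where B = 1] AE_I2 mult_le_one)
  have "(\<integral>\<^sup>+w. ennreal ((cmod (fourier_transform P w))\<^sup>2) \<partial>difference_distr Q)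
      = ennreal (LINT p|difference_distr P. ?q p)"
    unfolding integral_fourier_difference_distr_commute[OF assms(1) DQ.borel_prob_axioms]
    by (simp only: FT_DQ integral_complex_of_real Re_complex_of_real)
  also have "\<dots> \<le> ennreal (LINT p|difference_distr P. exp (4 * pi * R\<^sup>2) * (?q p * exp (- pi * (norm p)\<^sup>2)))"
  proof (intro ennreal_leI integral_mono_AE)
    show "AE p in difference_distr P. ?q p \<le> exp (4 * pi * R\<^sup>2) * (?q p * exp (- pi * (norm p)\<^sup>2))"
      using P.AE_difference_distr_norm_le[OF R]
    proof eventually_elim
      case (elim p)
      then have "(norm p)\<^sup>2 \<le> (2 * R)\<^sup>2" by (intro power_mono) auto
      then have "pi * (norm p)\<^sup>2 \<le> 4 * pi * R\<^sup>2" by (simp add: power_mult_distrib)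
      then have "1 \<le> exp (4 * pi * R\<^sup>2) * exp (- pi * (norm p)\<^sup>2)"
        by (simp flip: exp_add)
      then show ?case using mult_left_mono[OF _ q(1)] by (fastforce simp: mult_ac)
    qed
  qed (use int in auto)
  also have "\<dots> = ennreal (exp (4 * pi * R\<^sup>2)) * ennreal (LINT p|difference_distr P. ?q p * exp (- pi * (norm p)\<^sup>2))"
    by (simp add: ennreal_mult')
  also have "ennreal (LINT p|difference_distr P. ?q p * exp (- pi * (norm p)\<^sup>2))
      = (\<integral>\<^sup>+w. ennreal ((cmod (fourier_transform P w))\<^sup>2) \<partial>gauss_convolution (difference_distr Q))"
    unfolding integral_fourier_difference_distr_commute[OF assms(1) DQ.borel_prob_gauss_convolution]
    by (simp only: FT_DQ_gauss integral_complex_of_real Re_complex_of_real)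
  finally show ?thesis .
qed

text \<open>
  Half of the Gaussian centred at \<open>w\<close> is traded for a cutoff in \<open>v\<close> at scale \<open>T\<close>, because
  \<open>|v|\<^sup>2 \<le> 2 |v - w|\<^sup>2 + 2 |w|\<^sup>2\<close>.
\<close>

lemma exp_gaussian_le_shifted:
  fixes v w :: "'a::real_normed_vector"
  assumes "norm w \<le> 2 * T" "T \<ge> 1"
  shows "exp (- pi * (norm (v - w))\<^sup>2)
    \<le> exp (2 * pi) * exp (- (pi / 4) * (norm v / T)\<^sup>2) * exp (- (pi / 2) * (norm (v - w))\<^sup>2)"
proof -
  have "(norm v)\<^sup>2 \<le> (norm (v - w) + norm w)\<^sup>2"
    using norm_triangle_ineq[of "v - w" w] by (intro power_mono) auto
  also have "\<dots> \<le> 2 * (norm (v - w))\<^sup>2 + 2 * (norm w)\<^sup>2"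
    using sum_squares_bound[of "norm (v - w)" "norm w"] by (simp add: power2_sum)
  also have "\<dots> \<le> 2 * (norm (v - w))\<^sup>2 * T\<^sup>2 + 2 * (2 * T)\<^sup>2"
    using assms by (intro add_mono mult_left_mono power_mono) (auto simp: mult_le_cancel_left1 one_le_power)
  finally have "(norm v)\<^sup>2 \<le> (2 * (norm (v - w))\<^sup>2 + 8) * T\<^sup>2"
    by (simp add: algebra_simps power_mult_distrib)
  then have "(norm v / T)\<^sup>2 \<le> 2 * (norm (v - w))\<^sup>2 + 8"
    using assms by (simp add: power_divide pos_divide_le_eq)
  then have "(pi / 4) * (norm v / T)\<^sup>2 \<le> (pi / 4) * (2 * (norm (v - w))\<^sup>2 + 8)"
    by (intro mult_left_mono) auto
  then show ?thesis
    by (simp add: algebra_simps flip: exp_add)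
qed

text \<open>
  After the smoothing the left integral is \<open>\<integral> |FT P|\<^sup>2 g\<close> for a smooth density \<open>g\<close> that is
  concentrated on \<open>|v| \<le> 2 T\<close> up to Gaussian tails. The Cauchy-Schwarz inequality separates \<open>P\<close> from
  \<open>Q\<close>, and the square integral of \<open>g\<close> is a Gaussian energy of the differences of \<open>Q\<close>, hence a
  truncated fourth moment of \<open>FT Q\<close>.
\<close>

lemma fourier_pairing_bound:
  fixes P Q :: "'a::euclidean_space measure"
  assumes "borel_prob P" "borel_prob Q"
    and R: "AE x in P. norm x \<le> R" and T: "AE y in Q. norm y \<le> T" "T \<ge> 1"
  shows "(\<integral>\<^sup>+w. ennreal ((cmod (fourier_transform P w))\<^sup>2) \<partial>difference_distr Q)\<^sup>2
       \<le> ennreal (exp (8 * pi * R\<^sup>2 + 4 * pi) * 2 ^ DIM('a))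
          * (\<integral>\<^sup>+v. ennreal (cmod (fourier_transform P v) ^ 4 * exp (- (pi / 2) * (norm v / T)\<^sup>2)) \<partial>lborel)
          * (\<integral>\<^sup>+z. ennreal (cmod (fourier_transform Q z) ^ 4 * exp (- (4 * pi) * (norm z)\<^sup>2)) \<partial>lborel)"
proof -
  interpret P: borel_prob P by fact
  interpret Q: borel_prob Q by fact
  interpret DQ: borel_prob "difference_distr Q" by (rule Q.borel_prob_difference_distr)
  let ?p = "\<lambda>v. (cmod (fourier_transform P v))\<^sup>2"
  let ?f = "\<lambda>v. ennreal (?p v * exp (- (pi / 4) * (norm v / T)\<^sup>2))"
  let ?g = "\<lambda>v. \<integral>\<^sup>+w. ennreal (exp (- (pi / 2) * (norm (v - w))\<^sup>2)) \<partial>difference_distr Q"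
  have "(\<integral>\<^sup>+w. ennreal (?p w) \<partial>difference_distr Q)
      \<le> ennreal (exp (4 * pi * R\<^sup>2)) * (\<integral>\<^sup>+w. ennreal (?p w) \<partial>gauss_convolution (difference_distr Q))"
    by (rule fourier_square_integral_le_smoothed) fact+
  also have "(\<integral>\<^sup>+w. ennreal (?p w) \<partial>gauss_convolution (difference_distr Q))
      = (\<integral>\<^sup>+v. ennreal (?p v) * (\<integral>\<^sup>+w. ennreal (exp (- pi * (norm (v - w))\<^sup>2)) \<partial>difference_distr Q) \<partial>lborel)"
    by (rule DQ.nn_integral_gauss_convolution) measurable
  also have "\<dots> \<le> (\<integral>\<^sup>+v. ennreal (exp (2 * pi)) * (?f v * ?g v) \<partial>lborel)"
  proof (rule nn_integral_mono)
    fix v :: 'a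
    have "(\<integral>\<^sup>+w. ennreal (exp (- pi * (norm (v - w))\<^sup>2)) \<partial>difference_distr Q)
        \<le> (\<integral>\<^sup>+w. ennreal (exp (2 * pi) * exp (- (pi / 4) * (norm v / T)\<^sup>2)) * ennreal (exp (- (pi / 2) * (norm (v - w))\<^sup>2)) \<partial>difference_distr Q)"
    proof (rule nn_integral_mono_AE)
      show "AE w in difference_distr Q. ennreal (exp (- pi * (norm (v - w))\<^sup>2))
        \<le> ennreal (exp (2 * pi) * exp (- (pi / 4) * (norm v / T)\<^sup>2)) * ennreal (exp (- (pi / 2) * (norm (v - w))\<^sup>2))"
        using Q.AE_difference_distr_norm_le[OF T(1)]
        by eventually_elim (use exp_gaussian_le_shifted T(2) in \<open>auto simp flip: ennreal_mult intro!: ennreal_leI\<close>)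
    qed
    also have "\<dots> = ennreal (exp (2 * pi) * exp (- (pi / 4) * (norm v / T)\<^sup>2)) * ?g v"
      by (rule nn_integral_cmult) measurable
    finally have "ennreal (?p v) * (\<integral>\<^sup>+w. ennreal (exp (- pi * (norm (v - w))\<^sup>2)) \<partial>difference_distr Q)
        \<le> ennreal (?p v) * (ennreal (exp (2 * pi) * exp (- (pi / 4) * (norm v / T)\<^sup>2)) * ?g v)"
      by (rule mult_left_mono) simp
    also have "\<dots> = ennreal (exp (2 * pi)) * (?f v * ?g v)"
      by (simp add: ennreal_mult mult_ac)
    finally show "ennreal (?p v) * (\<integral>\<^sup>+w. ennreal (exp (- pi * (norm (v - w))\<^sup>2)) \<partial>difference_distr Q)
        \<le> ennreal (exp (2 * pi)) * (?f v * ?g v)" .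
  qed
  also have "\<dots> = ennreal (exp (2 * pi)) * (\<integral>\<^sup>+v. ?f v * ?g v \<partial>lborel)"
    by (rule nn_integral_cmult) measurable
  finally have "(\<integral>\<^sup>+w. ennreal (?p w) \<partial>difference_distr Q)
      \<le> ennreal (exp (4 * pi * R\<^sup>2 + 2 * pi)) * (\<integral>\<^sup>+v. ?f v * ?g v \<partial>lborel)"
    by (simp add: mult.assoc mult_left_mono exp_add ennreal_mult)
  then have "(\<integral>\<^sup>+w. ennreal (?p w) \<partial>difference_distr Q)\<^sup>2
      \<le> (ennreal (exp (4 * pi * R\<^sup>2 + 2 * pi)) * (\<integral>\<^sup>+v. ?f v * ?g v \<partial>lborel))\<^sup>2"
    by (rule power_mono) simp
  also have "\<dots> = ennreal (exp (8 * pi * R\<^sup>2 + 4 * pi)) * (\<integral>\<^sup>+v. ?f v * ?g v \<partial>lborel)\<^sup>2"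
    by (simp add: power_mult_distrib ennreal_power flip: exp_double) (simp add: algebra_simps)
  also have "\<dots> \<le> ennreal (exp (8 * pi * R\<^sup>2 + 4 * pi)) * ((\<integral>\<^sup>+v. ?f v ^ 2 \<partial>lborel) * (\<integral>\<^sup>+v. ?g v ^ 2 \<partial>lborel))"
    by (intro mult_left_mono Cauchy_Schwarz_nn_integral) auto
  also have "(\<integral>\<^sup>+v. ?f v ^ 2 \<partial>lborel)
      = (\<integral>\<^sup>+v. ennreal (cmod (fourier_transform P v) ^ 4 * exp (- (pi / 2) * (norm v / T)\<^sup>2)) \<partial>lborel)"
    by (simp add: ennreal_power power_mult_distrib flip: exp_double power_mult)
  also have "(\<integral>\<^sup>+v. ?g v ^ 2 \<partial>lborel)
      = (\<integral>\<^sup>+z. ennreal (gauss_density 2 z * (cmod (fourier_transform (difference_distr Q) z))\<^sup>2) \<partial>lborel)"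
    by (rule DQ.nn_integral_gauss_smoothing_square)
  also have "\<dots> = (\<integral>\<^sup>+z. ennreal (2 ^ DIM('a)) * ennreal (cmod (fourier_transform Q z) ^ 4 * exp (- (4 * pi) * (norm z)\<^sup>2)) \<partial>lborel)"
    by (simp add: gauss_density_def Q.fourier_transform_difference_distr norm_power mult_ac
        flip: power_mult ennreal_mult)
  also have "\<dots> = ennreal (2 ^ DIM('a)) * (\<integral>\<^sup>+z. ennreal (cmod (fourier_transform Q z) ^ 4 * exp (- (4 * pi) * (norm z)\<^sup>2)) \<partial>lborel)"
    by (rule nn_integral_cmult) measurable
  finally show ?thesis by (simp add: ennreal_mult mult_ac)
qed

definition scale_distr :: "real \<Rightarrow> 'a::euclidean_space measure \<Rightarrow> 'a measure" where
  "scale_distr c M = distr M borel (\<lambda>x. c *\<^sub>R x)"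

text \<open>
  Squared distances are used in place of distances because the difference
  \<open>|x - y|\<^sup>2 - |x - y'|\<^sup>2\<close> is affine in \<open>x\<close>.
\<close>

definition squared_distance_distr :: "'a::euclidean_space measure \<Rightarrow> 'a \<Rightarrow> real measure" where
  "squared_distance_distr M x = distr M borel (\<lambda>y. (dist x y)\<^sup>2)"

context borel_prob
begin

lemma borel_prob_scale_distr: "borel_prob (scale_distr c M)"
  by (auto simp: borel_prob_def borel_prob_axioms_def scale_distr_def intro!: prob_space_distr)

lemma fourier_transform_scale_distr:
  "fourier_transform (scale_distr c M) z = fourier_transform M (c *\<^sub>R z)"
  unfolding fourier_transform_cis scale_distr_def by (subst integral_distr) auto

lemma AE_scale_distr_norm_le:
  assumes "AE x in M. norm x \<le> R" "c \<ge> 0"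
  shows "AE x in scale_distr c M. norm x \<le> c * R"
  unfolding scale_distr_def using assms
  by (subst AE_distr_iff) (auto elim!: eventually_mono intro: mult_left_mono)

lemma borel_prob_squared_distance_distr: "borel_prob (squared_distance_distr M x)"
  by (auto simp: borel_prob_def borel_prob_axioms_def squared_distance_distr_def intro!: prob_space_distr)

lemma fourier_transform_squared_distance_distr:
  "fourier_transform (squared_distance_distr M x) t = (LINT y|M. cis (-2 * pi * t * (dist x y)\<^sup>2))"
  unfolding fourier_transform_cis squared_distance_distr_def
  by (subst integral_distr) (auto simp: mult.assoc)

lemma measurable_fourier_transform_squared_distance_distr [measurable]:
  "(\<lambda>(x, t). fourier_transform (squared_distance_distr M x) t) \<in> borel_measurable (borel \<Otimes>\<^sub>M borel)"
  unfolding fourier_transform_squared_distance_distr by measurable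

lemma fourier_transform_squared_distance_square:
  "complex_of_real ((cmod (fourier_transform (squared_distance_distr M x) t))\<^sup>2)
     = (LINT p|(M \<Otimes>\<^sub>M M). cis (-2 * pi * t * ((dist x (fst p))\<^sup>2 - (dist x (snd p))\<^sup>2)))"
proof -
  interpret MM: pair_prob_space M M ..
  let ?u = "\<lambda>y. cis (-2 * pi * t * (dist x y)\<^sup>2)"
  have [measurable]: "cnj \<in> borel_measurable borel"
    by (intro borel_measurable_continuous_onI continuous_intros)
  have int: "integrable (M \<Otimes>\<^sub>M M) (\<lambda>p. ?u (fst p) * cnj (?u (snd p)))"
    by (rule MM.integrable_const_bound[where B = 1]) (auto simp: norm_mult)
  have "(LINT p|(M \<Otimes>\<^sub>M M). cis (-2 * pi * t * ((dist x (fst p))\<^sup>2 - (dist x (snd p))\<^sup>2)))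
      = (LINT p|(M \<Otimes>\<^sub>M M). ?u (fst p) * cnj (?u (snd p)))"
    by (simp add: cis_mult cis_cnj right_diff_distrib)
  also have "\<dots> = (LINT y|M. LINT y'|M. ?u y * cnj (?u y'))"
    using MM.integral_fst'[OF int] by simp
  also have "\<dots> = (LINT y|M. ?u y) * cnj (LINT y|M. ?u y)"
    by simp
  finally show ?thesis
    unfolding complex_norm_square fourier_transform_squared_distance_distr ..
qed

end

text \<open>
  Expanding the square gives a double integral over \<open>y\<close>, \<open>y'\<close> of a phase that is affine in \<open>x\<close>.
  Integrating \<open>x\<close> first yields a unimodular factor times \<open>FT \<mu> (- 2 t (y - y'))\<close>; the bound follows on
  taking absolute values and applying the Cauchy-Schwarz inequality.
\<close>

lemma mean_square_fourier_squared_distance_le: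
  fixes \<mu> \<nu> :: "'a::euclidean_space measure"
  assumes "borel_prob \<mu>" "borel_prob \<nu>"
  shows "(\<integral>\<^sup>+x. ennreal ((cmod (fourier_transform (squared_distance_distr \<nu> x) t))\<^sup>2) \<partial>\<mu>)\<^sup>2
     \<le> (\<integral>\<^sup>+w. ennreal ((cmod (fourier_transform \<mu> w))\<^sup>2) \<partial>difference_distr (scale_distr (2 * t) \<nu>))"
proof -
  interpret \<mu>: borel_prob \<mu> by fact
  interpret \<nu>: borel_prob \<nu> by fact
  interpret NN: pair_prob_space \<nu> \<nu> ..
  interpret MNN: pair_prob_space \<mu> "\<nu> \<Otimes>\<^sub>M \<nu>" ..
  interpret S: borel_prob "scale_distr (2 * t) \<nu>" by (rule \<nu>.borel_prob_scale_distr)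
  let ?g = "\<lambda>x (y, y'). cis (-2 * pi * t * ((dist x y)\<^sup>2 - (dist x y')\<^sup>2))"
  let ?F = "\<lambda>x. (cmod (fourier_transform (squared_distance_distr \<nu> x) t))\<^sup>2"
  let ?h = "\<lambda>(y, y'). cmod (fourier_transform \<mu> ((2 * t) *\<^sub>R y - (2 * t) *\<^sub>R y'))"
  have F1: "?F x \<le> 1" for x
    using borel_prob.cmod_fourier_transform_le_1[OF \<nu>.borel_prob_squared_distance_distr]
    by (simp add: power_le_one)
  have [measurable]: "(\<lambda>x. fourier_transform (squared_distance_distr \<nu> x) t) \<in> borel_measurable borel"
    by measurable
  have phase: "(LINT x|\<mu>. ?g x p) = cis (-2 * pi * t * ((norm (fst p))\<^sup>2 - (norm (snd p))\<^sup>2))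
      * fourier_transform \<mu> (- ((2 * t) *\<^sub>R fst p - (2 * t) *\<^sub>R snd p))" for p
  proof -
    have "?g x p = cis (-2 * pi * t * ((norm (fst p))\<^sup>2 - (norm (snd p))\<^sup>2))
        * cis (-2 * pi * (- ((2 * t) *\<^sub>R fst p - (2 * t) *\<^sub>R snd p) \<bullet> x))" for x
      unfolding cis_mult dist_norm power2_norm_eq_inner
      by (auto simp: split_beta' algebra_simps inner_commute intro!: arg_cong[where f = cis])
    then show ?thesis unfolding fourier_transform_cis by simp
  qed
  have "complex_of_real (LINT x|\<mu>. ?F x) = (LINT x|\<mu>. LINT p|(\<nu> \<Otimes>\<^sub>M \<nu>). ?g x p)"
    unfolding integral_complex_of_real[symmetric] \<nu>.fourier_transform_squared_distance_square
    by (simp add: split_beta')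
  also have "\<dots> = (LINT p|(\<nu> \<Otimes>\<^sub>M \<nu>). LINT x|\<mu>. ?g x p)"
    using MNN.Fubini_integral[of ?g] MNN.integrable_const_bound[of "case_prod ?g" 1]
    by (simp add: split_beta')
  finally have "cmod (complex_of_real (LINT x|\<mu>. ?F x)) = cmod (LINT p|(\<nu> \<Otimes>\<^sub>M \<nu>). LINT x|\<mu>. ?g x p)"
    by (rule arg_cong)
  then have "(LINT x|\<mu>. ?F x) = cmod (LINT p|(\<nu> \<Otimes>\<^sub>M \<nu>). LINT x|\<mu>. ?g x p)"
    unfolding norm_of_real by simp
  then have "(\<integral>\<^sup>+x. ennreal (?F x) \<partial>\<mu>) = ennreal (cmod (LINT p|(\<nu> \<Otimes>\<^sub>M \<nu>). LINT x|\<mu>. ?g x p))"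
    using F1 by (subst nn_integral_eq_integral) (auto intro!: \<mu>.integrable_const_bound[where B = 1] AE_I2)
  also have "\<dots> \<le> (\<integral>\<^sup>+p. ennreal (cmod (LINT x|\<mu>. ?g x p)) \<partial>(\<nu> \<Otimes>\<^sub>M \<nu>))"
    unfolding phase
    by (intro integral_norm_bound_ennreal NN.integrable_const_bound[where B = 1])
      (auto intro!: AE_I2 \<mu>.cmod_fourier_transform_le_1 simp: norm_mult)
  also have "\<dots> = (\<integral>\<^sup>+p. ennreal (?h p) * 1 \<partial>(\<nu> \<Otimes>\<^sub>M \<nu>))"
    unfolding phase by (simp add: norm_mult \<mu>.fourier_transform_minus split_beta' del: minus_diff_eq)
  finally have "(\<integral>\<^sup>+x. ennreal (?F x) \<partial>\<mu>)\<^sup>2 \<le> (\<integral>\<^sup>+p. ennreal (?h p) * 1 \<partial>(\<nu> \<Otimes>\<^sub>M \<nu>))\<^sup>2"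
    by (rule power_mono) simp
  also have "\<dots> \<le> (\<integral>\<^sup>+p. (ennreal (?h p))\<^sup>2 \<partial>(\<nu> \<Otimes>\<^sub>M \<nu>)) * (\<integral>\<^sup>+p. 1\<^sup>2 \<partial>(\<nu> \<Otimes>\<^sub>M \<nu>))"
    by (rule Cauchy_Schwarz_nn_integral) measurable
  also have "\<dots> = (\<integral>\<^sup>+p. (ennreal (?h p))\<^sup>2 \<partial>(\<nu> \<Otimes>\<^sub>M \<nu>))"
    by (simp add: NN.emeasure_space_1)
  also have "\<dots> = (\<integral>\<^sup>+y. \<integral>\<^sup>+y'. (ennreal (?h (y, y')))\<^sup>2 \<partial>\<nu> \<partial>\<nu>)"
    by (subst \<nu>.nn_integral_fst[symmetric]) (auto simp: split_beta')
  also have "\<dots> = (\<integral>\<^sup>+w. ennreal ((cmod (fourier_transform \<mu> w))\<^sup>2) \<partial>difference_distr (scale_distr (2 * t) \<nu>))"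
    by (simp add: S.nn_integral_difference_distr) (simp add: scale_distr_def nn_integral_distr ennreal_power)
  finally show ?thesis .
qed

section \<open>Decay of the mean square and finiteness of the average energy\<close>

lemma fourier_energy_integral_half:
  fixes M :: "'a::euclidean_space measure"
  shows "fourier_energy_integral s (1/2) M
    = (\<integral>\<^sup>+z. ennreal (cmod (fourier_transform M z) ^ 4 * norm z powr (- (real DIM('a) - 2 * s))) \<partial>lborel)"
  unfolding fourier_energy_integral_def by (simp add: powr_numeral mult.commute)

text \<open>
  The pairing bound with \<open>P = \<mu>\<close> and \<open>Q\<close> the dilation of \<open>\<nu>\<close> by \<open>2 t\<close>. The two truncated fourth
  moments contribute \<open>t powr (d - 2 s\<^sub>1)\<close> and \<open>t powr (d - 2 s\<^sub>2)\<close>, and undoing the dilation contributes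
  \<open>t powr (- d)\<close>. Since two squarings were used, this bounds the fourth power of the mean square, and the
  exponent is \<open>(d - 2 s\<^sub>1 - 2 s\<^sub>2) / 4\<close>.
\<close>

lemma mean_square_fourier_decay:
  fixes \<mu> \<nu> :: "'a::euclidean_space measure"
  assumes "borel_prob \<mu>" "borel_prob \<nu>"
    and R: "AE x in \<mu>. norm x \<le> R" "AE y in \<nu>. norm y \<le> R"
    and s: "s\<^sub>1 \<le> real DIM('a) / 2" "s\<^sub>2 \<le> real DIM('a) / 2"
    and J: "fourier_energy_integral s\<^sub>1 (1/2) \<mu> < \<infinity>" "fourier_energy_integral s\<^sub>2 (1/2) \<nu> < \<infinity>"
  obtains K where "K > 0" "\<And>t. \<bar>t\<bar> \<ge> 1 \<Longrightarrow>
    (\<integral>\<^sup>+x. ennreal ((cmod (fourier_transform (squared_distance_distr \<nu> x) t))\<^sup>2) \<partial>\<mu>)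
      \<le> ennreal (K * \<bar>t\<bar> powr (- ((s\<^sub>1 + s\<^sub>2) / 2 - real DIM('a) / 4)))"
proof -
  interpret \<mu>: borel_prob \<mu> by fact
  interpret \<nu>: borel_prob \<nu> by fact
  let ?A = "\<lambda>t. \<integral>\<^sup>+x. ennreal ((cmod (fourier_transform (squared_distance_distr \<nu> x) t))\<^sup>2) \<partial>\<mu>"
  define d where "d = real DIM('a)"
  define b\<^sub>1 where "b\<^sub>1 = d - 2 * s\<^sub>1"
  define b\<^sub>2 where "b\<^sub>2 = d - 2 * s\<^sub>2"
  \<comment> \<open>The cutoff scale \<open>2 t S\<close> has to be at least \<open>1\<close> for all \<open>t \<ge> 1\<close>.\<close>
  define S where "S = max R 1"
  have S: "AE x in \<mu>. norm x \<le> S" "AE y in \<nu>. norm y \<le> S" "S \<ge> 1"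
    using R by (auto simp: S_def elim!: eventually_mono)
  have b: "b\<^sub>1 \<ge> 0" "b\<^sub>2 \<ge> 0" using s by (auto simp: b\<^sub>1_def b\<^sub>2_def d_def)
  obtain j\<^sub>1 where j\<^sub>1: "fourier_energy_integral s\<^sub>1 (1/2) \<mu> = ennreal j\<^sub>1" "j\<^sub>1 \<ge> 0"
    using J(1) by (cases "fourier_energy_integral s\<^sub>1 (1/2) \<mu>") auto
  obtain j\<^sub>2 where j\<^sub>2: "fourier_energy_integral s\<^sub>2 (1/2) \<nu> = ennreal j\<^sub>2" "j\<^sub>2 \<ge> 0"
    using J(2) by (cases "fourier_energy_integral s\<^sub>2 (1/2) \<nu>") auto
  obtain C\<^sub>1 where C\<^sub>1: "C\<^sub>1 > 0"
    "\<And>t (f :: 'a \<Rightarrow> real). t > 0 \<Longrightarrow> f \<in> borel_measurable borel \<Longrightarrow> (\<And>v. f v \<ge> 0) \<Longrightarrow>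
       (\<integral>\<^sup>+v. ennreal (f v * exp (- (pi / 2) * (norm v / t)\<^sup>2)) \<partial>lborel)
         \<le> ennreal (C\<^sub>1 * t powr b\<^sub>1) * (\<integral>\<^sup>+v. ennreal (f v * norm v powr (- b\<^sub>1)) \<partial>lborel)"
    using nn_integral_gaussian_cutoff_le[OF b(1) pi_half_gt_zero, where 'a = 'a] by blast
  obtain C\<^sub>2 where C\<^sub>2: "C\<^sub>2 > 0"
    "\<And>t (f :: 'a \<Rightarrow> real). t > 0 \<Longrightarrow> f \<in> borel_measurable borel \<Longrightarrow> (\<And>v. f v \<ge> 0) \<Longrightarrow>
       (\<integral>\<^sup>+v. ennreal (f v * exp (- pi * (norm v / t)\<^sup>2)) \<partial>lborel)
         \<le> ennreal (C\<^sub>2 * t powr b\<^sub>2) * (\<integral>\<^sup>+v. ennreal (f v * norm v powr (- b\<^sub>2)) \<partial>lborel)"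
    using nn_integral_gaussian_cutoff_le[OF b(2) pi_gt_zero, where 'a = 'a] by blast
  define K where "K = exp (8 * pi * S\<^sup>2 + 4 * pi) * (C\<^sub>1 * (2 * S) powr b\<^sub>1 * j\<^sub>1) * (C\<^sub>2 * j\<^sub>2)"
  have K: "K \<ge> 0" using C\<^sub>1(1) C\<^sub>2(1) j\<^sub>1 j\<^sub>2 by (simp add: K_def)
  have fourth_power: "?A t ^ 4 \<le> ennreal (K * t powr (b\<^sub>1 + b\<^sub>2 - d))" if t: "t \<ge> 1" for t
  proof -
    let ?Q = "scale_distr (2 * t) \<nu>"
    let ?X = "\<integral>\<^sup>+w. ennreal ((cmod (fourier_transform \<mu> w))\<^sup>2) \<partial>difference_distr ?Q"
    let ?I = "\<integral>\<^sup>+z. ennreal (cmod (fourier_transform ?Q z) ^ 4 * exp (- (4 * pi) * (norm z)\<^sup>2)) \<partial>lborel"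
    let ?I' = "\<integral>\<^sup>+v. ennreal (cmod (fourier_transform \<mu> v) ^ 4 * exp (- (pi / 2) * (norm v / (2 * t * S))\<^sup>2)) \<partial>lborel"
    have "?A t ^ 4 = ((?A t)\<^sup>2)\<^sup>2" by simp
    also have "\<dots> \<le> ?X\<^sup>2"
      by (intro power_mono mean_square_fourier_squared_distance_le \<mu>.borel_prob_axioms \<nu>.borel_prob_axioms) auto
    also have "\<dots> \<le> ennreal (exp (8 * pi * S\<^sup>2 + 4 * pi) * 2 ^ DIM('a)) * ?I' * ?I"
    proof (rule fourier_pairing_bound)
      show "AE y in ?Q. norm y \<le> 2 * t * S"
        using t by (intro \<nu>.AE_scale_distr_norm_le S) auto
      show "1 \<le> 2 * t * S"
        using t S(3) mult_mono[of 1 t 1 S] by auto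
    qed (use \<mu>.borel_prob_axioms \<nu>.borel_prob_scale_distr S in auto)
    also have "\<dots> = ennreal (exp (8 * pi * S\<^sup>2 + 4 * pi)) * ?I' * (ennreal (2 ^ DIM('a)) * ?I)"
      by (simp add: ennreal_mult mult_ac)
    also have "\<dots> \<le> ennreal (exp (8 * pi * S\<^sup>2 + 4 * pi)) * ennreal (C\<^sub>1 * (2 * t * S) powr b\<^sub>1 * j\<^sub>1)
        * ennreal (C\<^sub>2 * t powr b\<^sub>2 * t powr (- d) * j\<^sub>2)"
    proof (intro mult_mono)
      have "?I' \<le> ennreal (C\<^sub>1 * (2 * t * S) powr b\<^sub>1) * fourier_energy_integral s\<^sub>1 (1/2) \<mu>"
        unfolding fourier_energy_integral_half b\<^sub>1_def[unfolded d_def, symmetric]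
        using t S(3) by (intro C\<^sub>1(2)) auto
      then show "?I' \<le> ennreal (C\<^sub>1 * (2 * t * S) powr b\<^sub>1 * j\<^sub>1)"
        using C\<^sub>1(1) j\<^sub>1 by (simp add: ennreal_mult)
    next
      have "ennreal (t powr d) * (ennreal (2 ^ DIM('a)) * ?I)
          = ennreal ((2 * t) ^ DIM('a)) * ?I"
        using t by (simp add: d_def powr_realpow power_mult_distrib ennreal_mult mult_ac)
      also have "\<dots> = (\<integral>\<^sup>+v. ennreal (cmod (fourier_transform \<nu> v) ^ 4 * exp (- pi * (norm v / t)\<^sup>2)) \<partial>lborel)"
        using t by (subst nn_integral_lborel_scale[where c = "2 * t"])
          (auto simp: \<nu>.fourier_transform_scale_distr power_mult_distrib mult_ac)
      also have "\<dots> \<le> ennreal (C\<^sub>2 * t powr b\<^sub>2) * fourier_energy_integral s\<^sub>2 (1/2) \<nu>"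
        unfolding fourier_energy_integral_half b\<^sub>2_def[unfolded d_def, symmetric]
        using t by (intro C\<^sub>2(2)) auto
      also have "\<dots> = ennreal (C\<^sub>2 * t powr b\<^sub>2 * j\<^sub>2)"
        using C\<^sub>2(1) j\<^sub>2 by (simp add: ennreal_mult)
      finally have "ennreal (t powr (- d)) * (ennreal (t powr d) * (ennreal (2 ^ DIM('a)) * ?I))
          \<le> ennreal (t powr (- d)) * ennreal (C\<^sub>2 * t powr b\<^sub>2 * j\<^sub>2)"
        by (rule mult_left_mono) simp
      moreover have "ennreal (t powr (- d)) * ennreal (t powr d) = 1"
        using t by (simp flip: ennreal_mult powr_add)
      moreover have "ennreal (t powr (- d)) * ennreal (C\<^sub>2 * t powr b\<^sub>2 * j\<^sub>2)
          = ennreal (C\<^sub>2 * t powr b\<^sub>2 * t powr (- d) * j\<^sub>2)"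
        using C\<^sub>2(1) j\<^sub>2 by (simp add: mult_ac flip: ennreal_mult)
      ultimately show "ennreal (2 ^ DIM('a)) * ?I \<le> ennreal (C\<^sub>2 * t powr b\<^sub>2 * t powr (- d) * j\<^sub>2)"
        by (simp only: mult.assoc[symmetric, of "ennreal (t powr (- d))" "ennreal (t powr d)"] mult_1)
    qed auto
    also have "\<dots> = ennreal (K * t powr (b\<^sub>1 + b\<^sub>2 - d))"
    proof -
      have "(2 * t * S) powr b\<^sub>1 = (2 * S) powr b\<^sub>1 * t powr b\<^sub>1"
        using t S(3) by (simp add: powr_mult)
      moreover have "t powr (b\<^sub>1 + b\<^sub>2 - d) = t powr b\<^sub>1 * t powr b\<^sub>2 * t powr (- d)"
        by (simp flip: powr_add)
      ultimately show ?thesis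
        using C\<^sub>1(1) C\<^sub>2(1) j\<^sub>1 j\<^sub>2 by (simp add: K_def mult_ac flip: ennreal_mult)
    qed
    finally show ?thesis .
  qed
  \<comment> \<open>Adding \<open>1\<close> makes the constant positive even if one of the energies vanishes.\<close>
  define K' where "K' = (K + 1) powr (1/4)"
  have bound: "?A t \<le> ennreal (K' * t powr (- ((s\<^sub>1 + s\<^sub>2) / 2 - d / 4)))" if t: "t \<ge> 1" for t
  proof -
    let ?y = "K' * t powr (- ((s\<^sub>1 + s\<^sub>2) / 2 - d / 4))"
    have "?A t ^ 4 \<le> ennreal ((K + 1) * t powr (b\<^sub>1 + b\<^sub>2 - d))"
      using fourth_power[OF t] by (rule order.trans) (auto intro!: ennreal_leI mult_right_mono)
    also have "(K + 1) * t powr (b\<^sub>1 + b\<^sub>2 - d) = ?y ^ 4"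
    proof -
      have "?y ^ 4 = ((K + 1) powr (1/4)) ^ 4 * (t powr (- ((s\<^sub>1 + s\<^sub>2) / 2 - d / 4))) ^ 4"
        by (simp add: K'_def power_mult_distrib)
      also have "\<dots> = (K + 1) * t powr (b\<^sub>1 + b\<^sub>2 - d)"
      proof -
        have "(t powr (- ((s\<^sub>1 + s\<^sub>2) / 2 - d / 4))) ^ 4 = t powr (4 * (- ((s\<^sub>1 + s\<^sub>2) / 2 - d / 4)))"
          using t by (simp add: powr_powr mult.commute flip: powr_numeral)
        also have "4 * (- ((s\<^sub>1 + s\<^sub>2) / 2 - d / 4)) = b\<^sub>1 + b\<^sub>2 - d"
          by (simp add: b\<^sub>1_def b\<^sub>2_def field_simps)
        finally show ?thesis using K by (simp add: powr_powr flip: powr_numeral)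
      qed
      finally show ?thesis ..
    qed
    finally have le: "?A t ^ 4 \<le> ennreal ?y ^ 4"
      by (simp add: K'_def ennreal_power)
    show ?thesis
    proof (cases "?A t")
      case (real a)
      then have "a ^ 4 \<le> ?y ^ 4"
        using le by (simp add: ennreal_power K'_def)
      then show ?thesis
        using real by (auto simp: K'_def intro!: ennreal_leI elim: power_le_imp_le_base)
    next
      case top
      then show ?thesis using le by (simp add: ennreal_power K'_def top_unique)
    qed
  qed
  show thesis
  proof (rule that)
    show "K' > 0" using K by (simp add: K'_def)
    fix t :: real assume t: "\<bar>t\<bar> \<ge> 1"
    have "?A t = ?A \<bar>t\<bar>"
      using borel_prob.fourier_transform_minus[OF \<nu>.borel_prob_squared_distance_distr, of _ t]
      by (cases "t \<ge> 0") (auto simp: abs_if)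
    then show "?A t \<le> ennreal (K' * \<bar>t\<bar> powr (- ((s\<^sub>1 + s\<^sub>2) / 2 - real DIM('a) / 4)))"
      using bound[OF t] by (simp add: d_def)
  qed
qed

lemma nn_integral_powr_tails:
  assumes "e > 1"
  shows "(\<integral>\<^sup>+t. ennreal (\<bar>t\<bar> powr (- e)) * indicator {t. \<bar>t\<bar> \<ge> 1} (t::real) \<partial>lborel) < \<infinity>"
proof -
  let ?g = "\<lambda>t::real. ennreal (\<bar>t\<bar> powr (- e)) * indicator {1..} t"
  have "(\<integral>\<^sup>+t. ?g t \<partial>lborel) = (\<integral>\<^sup>+t. ennreal (t powr (- e) * indicator {1..} t) \<partial>lborel)"
    by (intro nn_integral_cong) (auto split: split_indicator)
  also have "\<dots> = ennreal (- (1 powr (- e + 1)) / (- e + 1))"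
  proof (rule nn_integral_has_integral_lborel)
    have "(\<lambda>t::real. t powr (- e) * indicator {1..} t) = (\<lambda>t. if t \<in> {1..} then t powr (- e) else 0)"
      by (auto simp: indicator_def)
    then show "((\<lambda>t::real. t powr (- e) * indicator {1..} t) has_integral - (1 powr (- e + 1)) / (- e + 1)) UNIV"
      using assms has_integral_powr_to_inf[of "- e" 1] by (simp only: has_integral_restrict_UNIV)
  qed auto
  finally have fin: "(\<integral>\<^sup>+t. ?g t \<partial>lborel) < \<infinity>" by simp
  have refl: "(\<integral>\<^sup>+t. ?g (- t) \<partial>lborel) = (\<integral>\<^sup>+t. ?g t \<partial>lborel)"
    using nn_integral_real_affine[of ?g "-1" 0] by simp
  have "(\<integral>\<^sup>+t. ennreal (\<bar>t\<bar> powr (- e)) * indicator {t. \<bar>t\<bar> \<ge> 1} (t::real) \<partial>lborel)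
      \<le> (\<integral>\<^sup>+t. ?g t + ?g (- t) \<partial>lborel)"
    by (intro nn_integral_mono) (auto split: split_indicator)
  also have "\<dots> = (\<integral>\<^sup>+t. ?g t \<partial>lborel) + (\<integral>\<^sup>+t. ?g (- t) \<partial>lborel)"
    by (rule nn_integral_add) auto
  also have "\<dots> < \<infinity>" unfolding refl using fin by simp
  finally show ?thesis .
qed

lemma gauss_energy_squared_distance:
  fixes \<mu> \<nu> :: "'a::euclidean_space measure"
  assumes "borel_prob \<mu>" "borel_prob \<nu>" and "r > 0"
  shows "(\<integral>\<^sup>+x. \<integral>\<^sup>+y. \<integral>\<^sup>+y'. ennreal (exp (- pi * ((dist x y)\<^sup>2 - (dist x y')\<^sup>2)\<^sup>2 / r\<^sup>2)) \<partial>\<nu> \<partial>\<nu> \<partial>\<mu>)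
    = (\<integral>\<^sup>+t. ennreal (gauss_density r t)
        * (\<integral>\<^sup>+x. ennreal ((cmod (fourier_transform (squared_distance_distr \<nu> x) t))\<^sup>2) \<partial>\<mu>) \<partial>lborel)"
proof -
  interpret \<mu>: borel_prob \<mu> by fact
  interpret \<nu>: borel_prob \<nu> by fact
  interpret LM: pair_sigma_finite "lborel :: real measure" \<mu> ..
  let ?F = "\<lambda>t x. gauss_density r t * (cmod (fourier_transform (squared_distance_distr \<nu> x) t))\<^sup>2"
  have [measurable]: "(\<lambda>p. fourier_transform (squared_distance_distr \<nu> (snd p)) (fst p)) \<in> borel_measurable (borel \<Otimes>\<^sub>M borel)"
    using measurable_compose[OF measurable_pair_swap' \<nu>.measurable_fourier_transform_squared_distance_distr]
    by (simp add: split_beta')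
  have "(\<integral>\<^sup>+y. \<integral>\<^sup>+y'. ennreal (exp (- pi * ((dist x y)\<^sup>2 - (dist x y')\<^sup>2)\<^sup>2 / r\<^sup>2)) \<partial>\<nu> \<partial>\<nu>)
      = (\<integral>\<^sup>+t. ennreal (?F t x) \<partial>lborel)" for x
  proof -
    interpret D: borel_prob "squared_distance_distr \<nu> x"
      by (rule \<nu>.borel_prob_squared_distance_distr)
    have "(\<integral>\<^sup>+y. \<integral>\<^sup>+y'. ennreal (exp (- pi * ((dist x y)\<^sup>2 - (dist x y')\<^sup>2)\<^sup>2 / r\<^sup>2)) \<partial>\<nu> \<partial>\<nu>)
       = (\<integral>\<^sup>+u. \<integral>\<^sup>+u'. ennreal (exp (- pi * (norm (u - u'))\<^sup>2 / r\<^sup>2)) \<partial>squared_distance_distr \<nu> x \<partial>squared_distance_distr \<nu> x)"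
      unfolding squared_distance_distr_def by (simp add: nn_integral_distr)
    also have "\<dots> = (\<integral>\<^sup>+t. ennreal (?F t x) \<partial>lborel)"
      by (rule D.gauss_energy_eq) fact
    finally show ?thesis .
  qed
  then have "(\<integral>\<^sup>+x. \<integral>\<^sup>+y. \<integral>\<^sup>+y'. ennreal (exp (- pi * ((dist x y)\<^sup>2 - (dist x y')\<^sup>2)\<^sup>2 / r\<^sup>2)) \<partial>\<nu> \<partial>\<nu> \<partial>\<mu>)
      = (\<integral>\<^sup>+x. \<integral>\<^sup>+t. ennreal (?F t x) \<partial>lborel \<partial>\<mu>)"
    by simp
  also have "\<dots> = (\<integral>\<^sup>+t. \<integral>\<^sup>+x. ennreal (?F t x) \<partial>\<mu> \<partial>lborel)"
    by (rule LM.Fubini') measurable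
  also have "\<dots> = (\<integral>\<^sup>+t. ennreal (gauss_density r t)
        * (\<integral>\<^sup>+x. ennreal ((cmod (fourier_transform (squared_distance_distr \<nu> x) t))\<^sup>2) \<partial>\<mu>) \<partial>lborel)"
    using gauss_density_pos[OF assms(3), where 'a = real]
    by (simp add: ennreal_mult less_imp_le nn_integral_cmult)
  finally show ?thesis .
qed

text \<open>
  For \<open>|t| \<ge> 1\<close> the Gaussian is bounded by a multiple of \<open>(r |t|) powr (p - 1)\<close>. The resulting
  power \<open>|t| powr (p - 1 - a)\<close> is integrable at infinity since \<open>p < a\<close>. The part \<open>|t| < 1\<close> contributes
  \<open>O(r)\<close>, at most \<open>O(r powr p)\<close> since \<open>p < 1\<close> and \<open>r \<le> 1\<close>.
\<close>

lemma gauss_integral_decay_le: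
  fixes A :: "real \<Rightarrow> ennreal"
  assumes [measurable]: "A \<in> borel_measurable borel"
    and A1: "\<And>t. A t \<le> 1" and A: "\<And>t. \<bar>t\<bar> \<ge> 1 \<Longrightarrow> A t \<le> ennreal (K * \<bar>t\<bar> powr (- a))" and "K > 0"
    and p: "p < 1" "p < a"
  obtains C where "C \<ge> 0" "\<And>r. 0 < r \<Longrightarrow> r \<le> 1 \<Longrightarrow>
    (\<integral>\<^sup>+t. ennreal (gauss_density r t) * A t \<partial>lborel) \<le> ennreal (C * r powr p)"
proof -
  obtain C where C: "C > 0" "\<And>x. x > 0 \<Longrightarrow> x powr (1 - p) * exp (- pi * x\<^sup>2) \<le> C"
    using powr_times_gaussian_bounded[of "1 - p" pi] p(1) pi_gt_zero by (metis diff_ge_0_iff_ge less_imp_le)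
  define e where "e = 1 + a - p"
  define h :: "real \<Rightarrow> ennreal" where
    "h t = indicator {-1..1} t + ennreal (C * K) * (ennreal (\<bar>t\<bar> powr (- e)) * indicator {t. \<bar>t\<bar> \<ge> 1} t)" for t
  have [measurable]: "h \<in> borel_measurable borel" unfolding h_def by measurable
  have "(\<integral>\<^sup>+t. h t \<partial>lborel) < \<infinity>"
    using nn_integral_powr_tails[of e] p(2)
    by (simp add: h_def nn_integral_add nn_integral_cmult e_def ennreal_mult_less_top)
  then obtain H where H: "(\<integral>\<^sup>+t. h t \<partial>lborel) = ennreal H" "H \<ge> 0"
    by (cases "\<integral>\<^sup>+t. h t \<partial>lborel") auto
  have bound: "ennreal (gauss_density r t) * A t \<le> ennreal (r powr p) * h t" if r: "0 < r" "r \<le> 1" for r t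
  proof (cases "\<bar>t\<bar> \<ge> 1")
    case False
    have "gauss_density r t \<le> r" using r by (simp add: gauss_density_def mult_le_cancel_left1)
    also have "\<dots> \<le> r powr p" using powr_mono'[of p 1 r] p r by simp
    finally have "ennreal (gauss_density r t) * A t \<le> ennreal (r powr p) * 1"
      by (intro mult_mono A1 ennreal_leI) auto
    also have "\<dots> = ennreal (r powr p) * h t" using False by (auto simp: h_def abs_le_iff split: split_indicator)
    finally show ?thesis .
  next
    case True
    have "(r * \<bar>t\<bar>) powr (1 - p) * exp (- pi * (r * \<bar>t\<bar>)\<^sup>2) \<le> C"
      using r True by (intro C(2)) auto
    then have "exp (- pi * (r * \<bar>t\<bar>)\<^sup>2) \<le> C * (r * \<bar>t\<bar>) powr (- (1 - p))"
      using r True by (simp only: powr_minus) (simp add: field_simps)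
    then have "r * exp (- pi * (r * \<bar>t\<bar>)\<^sup>2) \<le> r * (C * (r * \<bar>t\<bar>) powr (- (1 - p)))"
      using r by (intro mult_left_mono) auto
    also have "\<dots> = C * r powr p * \<bar>t\<bar> powr (p - 1)"
      using r True by (simp add: powr_mult powr_diff)
    finally have g: "gauss_density r t \<le> C * r powr p * \<bar>t\<bar> powr (p - 1)"
      by (simp add: gauss_density_def power_mult_distrib mult_ac)
    have "ennreal (gauss_density r t) * A t
        \<le> ennreal (C * r powr p * \<bar>t\<bar> powr (p - 1)) * ennreal (K * \<bar>t\<bar> powr (- a))"
      using True by (intro mult_mono A ennreal_leI g) auto
    also have "\<dots> = ennreal (r powr p) * (ennreal (C * K) * ennreal (\<bar>t\<bar> powr (p - 1) * \<bar>t\<bar> powr (- a)))"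
      using C(1) \<open>K > 0\<close> by (simp add: mult_ac flip: ennreal_mult)
    also have "\<bar>t\<bar> powr (p - 1) * \<bar>t\<bar> powr (- a) = \<bar>t\<bar> powr (- e)"
      by (simp add: e_def algebra_simps flip: powr_add)
    also have "ennreal (r powr p) * (ennreal (C * K) * ennreal (\<bar>t\<bar> powr (- e))) \<le> ennreal (r powr p) * h t"
      using True by (intro mult_left_mono) (auto simp: h_def)
    finally show ?thesis .
  qed
  show thesis
  proof (rule that[OF H(2)])
    fix r :: real assume r: "0 < r" "r \<le> 1"
    have "(\<integral>\<^sup>+t. ennreal (gauss_density r t) * A t \<partial>lborel) \<le> (\<integral>\<^sup>+t. ennreal (r powr p) * h t \<partial>lborel)"
      by (intro nn_integral_mono bound r)
    also have "\<dots> = ennreal (H * r powr p)"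
      using H by (simp add: nn_integral_cmult ennreal_mult) (simp add: mult.commute)
    finally show "(\<integral>\<^sup>+t. ennreal (gauss_density r t) * A t \<partial>lborel) \<le> ennreal (H * r powr p)" .
  qed
qed

text \<open>
  A substitute for the Riesz kernel \<open>|u| powr (- s)\<close>, to which it is comparable for \<open>0 < |u| \<le> 1\<close>
  and \<open>s > 0\<close>. As a sum of Gaussians it needs no Fourier transform beyond the Gaussian one.
\<close>

definition dyadic_kernel :: "real \<Rightarrow> real \<Rightarrow> ennreal" where
  "dyadic_kernel s u = (\<Sum>k. ennreal ((2 powr s) ^ k * exp (- pi * u\<^sup>2 / ((1/2) ^ k)\<^sup>2)))"

lemma measurable_dyadic_kernel [measurable]: "dyadic_kernel s \<in> borel_measurable borel"
  unfolding dyadic_kernel_def by measurable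

text \<open>
  At scale \<open>r = 2 powr (- k)\<close> the average Gaussian energy is \<open>O (r powr p)\<close> for some
  \<open>p > u\<close>, so the dyadic sum is dominated by a geometric series with ratio \<open>2 powr (u - p)\<close>.
\<close>

lemma mean_dyadic_energy_finite:
  fixes \<mu> \<nu> :: "'a::euclidean_space measure"
  assumes "borel_prob \<mu>" "borel_prob \<nu>"
    and R: "AE x in \<mu>. norm x \<le> R" "AE y in \<nu>. norm y \<le> R"
    and s: "s\<^sub>1 \<le> real DIM('a) / 2" "s\<^sub>2 \<le> real DIM('a) / 2"
    and J: "fourier_energy_integral s\<^sub>1 (1/2) \<mu> < \<infinity>" "fourier_energy_integral s\<^sub>2 (1/2) \<nu> < \<infinity>"
    and u: "u < 1" "u < (s\<^sub>1 + s\<^sub>2) / 2 - real DIM('a) / 4"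
  shows "(\<integral>\<^sup>+x. \<integral>\<^sup>+y. \<integral>\<^sup>+y'. dyadic_kernel u ((dist x y)\<^sup>2 - (dist x y')\<^sup>2) \<partial>\<nu> \<partial>\<nu> \<partial>\<mu>) < \<infinity>"
proof -
  interpret \<mu>: borel_prob \<mu> by fact
  interpret \<nu>: borel_prob \<nu> by fact
  let ?A = "\<lambda>t. \<integral>\<^sup>+x. ennreal ((cmod (fourier_transform (squared_distance_distr \<nu> x) t))\<^sup>2) \<partial>\<mu>"
  let ?E = "\<lambda>r. \<integral>\<^sup>+x. \<integral>\<^sup>+y. \<integral>\<^sup>+y'. ennreal (exp (- pi * ((dist x y)\<^sup>2 - (dist x y')\<^sup>2)\<^sup>2 / r\<^sup>2)) \<partial>\<nu> \<partial>\<nu> \<partial>\<mu>"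
  let ?a = "(s\<^sub>1 + s\<^sub>2) / 2 - real DIM('a) / 4"
  have [measurable]: "(\<lambda>p. fourier_transform (squared_distance_distr \<nu> (snd p)) (fst p)) \<in> borel_measurable (borel \<Otimes>\<^sub>M borel)"
    using measurable_compose[OF measurable_pair_swap' \<nu>.measurable_fourier_transform_squared_distance_distr]
    by (simp add: split_beta')
  have A [measurable]: "?A \<in> borel_measurable borel" by measurable
  have A1: "?A t \<le> 1" for t
  proof -
    have "?A t \<le> (\<integral>\<^sup>+x. 1 \<partial>\<mu>)"
      using borel_prob.cmod_fourier_transform_le_1[OF \<nu>.borel_prob_squared_distance_distr]
      by (intro nn_integral_mono) (simp add: power_le_one)
    also have "\<dots> = 1" using \<mu>.emeasure_space_1 by simp
    finally show ?thesis .
  qed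
  obtain K where K: "K > 0" "\<And>t. \<bar>t\<bar> \<ge> 1 \<Longrightarrow> ?A t \<le> ennreal (K * \<bar>t\<bar> powr (- ?a))"
    using mean_square_fourier_decay[OF assms(1-8)] by blast
  obtain p where p: "u < p" "p < 1" "p < ?a" using dense[of u "min 1 ?a"] u by auto
  obtain C where C: "C \<ge> 0" "\<And>r. 0 < r \<Longrightarrow> r \<le> 1 \<Longrightarrow>
      (\<integral>\<^sup>+t. ennreal (gauss_density r t) * ?A t \<partial>lborel) \<le> ennreal (C * r powr p)"
    using gauss_integral_decay_le[OF A A1 K(2) K(1) p(2,3)] by blast
  define q where "q = 2 powr (u - p)"
  have q: "0 < q" "q < 1" using p(1) by (auto simp: q_def powr_less_one)
  have "(\<integral>\<^sup>+x. \<integral>\<^sup>+y. \<integral>\<^sup>+y'. dyadic_kernel u ((dist x y)\<^sup>2 - (dist x y')\<^sup>2) \<partial>\<nu> \<partial>\<nu> \<partial>\<mu>)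
      = (\<Sum>k. ennreal ((2 powr u) ^ k) * ?E ((1/2) ^ k))"
    unfolding dyadic_kernel_def by (simp add: nn_integral_suminf ennreal_mult' nn_integral_cmult)
  also have "\<dots> \<le> (\<Sum>k. ennreal (C * q ^ k))"
  proof (intro suminf_le allI)
    fix k
    have "?E ((1/2) ^ k) \<le> ennreal (C * ((1/2) ^ k) powr p)"
      by (subst gauss_energy_squared_distance[OF assms(1,2)]) (auto intro!: C(2) simp: power_le_one)
    then have "ennreal ((2 powr u) ^ k) * ?E ((1/2) ^ k) \<le> ennreal ((2 powr u) ^ k) * ennreal (C * ((1/2) ^ k) powr p)"
      by (rule mult_left_mono) simp
    also have "\<dots> = ennreal (C * q ^ k)"
    proof -
      have "((1/2) ^ k) powr p = (2 powr (- p)) ^ k"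
        by (simp add: powr_power powr_minus_divide powr_divide powr_powr mult.commute flip: powr_realpow)
      then show ?thesis
        using C(1) by (simp add: q_def power_mult_distrib[symmetric] powr_add[symmetric] mult.left_commute flip: ennreal_mult)
    qed
    finally show "ennreal ((2 powr u) ^ k) * ?E ((1/2) ^ k) \<le> ennreal (C * q ^ k)" .
  qed auto
  also have "\<dots> = ennreal (\<Sum>k. C * q ^ k)"
    using C(1) q by (intro suminf_ennreal2 summable_mult summable_geometric) auto
  also have "\<dots> < \<infinity>" by simp
  finally show ?thesis .
qed

section \<open>From finite energy to Hausdorff dimension\<close>

lemma dyadic_kernel_0:
  assumes "u \<ge> 0"
  shows "dyadic_kernel u 0 = \<infinity>"
proof -
  have "(\<Sum>k::nat. 1 :: ennreal) \<le> dyadic_kernel u 0"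
    unfolding dyadic_kernel_def
  proof (intro suminf_le allI)
    fix k :: nat
    have "1 \<le> (2 powr u) ^ k" using assms by (intro one_le_power) (auto simp: ge_one_powr_ge_zero)
    then show "1 \<le> ennreal ((2 powr u) ^ k * exp (- pi * 0\<^sup>2 / ((1/2) ^ k)\<^sup>2))"
      by simp
  qed auto
  moreover have "(\<Sum>k::nat. 1 :: ennreal) = \<infinity>"
    using nn_integral_count_space_nat[of "\<lambda>_. 1"] by (simp add: emeasure_count_space_infinite)
  ultimately show ?thesis by (simp add: top_unique)
qed

text \<open>
  The term whose scale satisfies \<open>2 powr (- k - 1) < D \<le> 2 powr (- k)\<close> suffices. The free exponent
  \<open>s \<le> u\<close> lets one finite energy serve all smaller dimensions.
\<close>

lemma dyadic_kernel_ge: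
  assumes s: "0 \<le> s" "s \<le> u" and D: "0 < D" "D \<le> 1" and v: "\<bar>v\<bar> \<le> D"
  shows "ennreal (exp (- pi) * 2 powr (- u) * D powr (- s)) \<le> dyadic_kernel u v"
proof -
  define k where "k = (LEAST n. (1/2::real) ^ Suc n < D)"
  have ex: "\<exists>n. (1/2::real) ^ Suc n < D"
  proof -
    obtain n where "(1/2::real) ^ n < D" using real_arch_pow_inv[of D "1/2"] D by auto
    moreover have "(1/2::real) ^ Suc n \<le> (1/2) ^ n" by (rule power_decreasing) auto
    ultimately have "(1/2::real) ^ Suc n < D" by linarith
    then show ?thesis ..
  qed
  have lower: "(1/2) ^ Suc k < D" unfolding k_def by (rule LeastI_ex[OF ex])
  have upper: "D \<le> (1/2) ^ k"
  proof (cases k)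
    case (Suc j)
    then have "j < (LEAST n. (1/2::real) ^ Suc n < D)" unfolding k_def by simp
    then have "\<not> (1/2::real) ^ Suc j < D" by (rule not_less_Least)
    then show ?thesis using Suc by simp
  qed (use D in auto)
  have "v\<^sup>2 \<le> ((1/2) ^ k)\<^sup>2" using v upper by (simp add: abs_le_square_iff[symmetric])
  then have "v\<^sup>2 / ((1/2) ^ k)\<^sup>2 \<le> 1" by (simp add: divide_le_eq)
  then have e: "exp (- pi) \<le> exp (- pi * v\<^sup>2 / ((1/2) ^ k)\<^sup>2)"
    by (simp add: mult_le_cancel_left2 flip: times_divide_eq_right)
  have "D powr (- s) \<le> D powr (- u)" using D s by (intro powr_mono') auto
  also have "\<dots> \<le> ((1/2) ^ Suc k) powr (- u)" using lower s by (intro powr_mono2') auto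
  also have "\<dots> = 2 powr (u * real (Suc k))"
  proof -
    have "(1/2::real) ^ Suc k = 2 powr (- real (Suc k))"
      by (simp only: powr_minus powr_realpow zero_less_numeral power_one_over inverse_eq_divide)
    then show ?thesis by (simp only: powr_powr minus_mult_minus mult.commute)
  qed
  also have "\<dots> = 2 powr u * (2 powr u) ^ k"
    by (simp add: powr_power distrib_left powr_add mult.commute)
  finally have "2 powr (- u) * D powr (- s) \<le> 2 powr (- u) * (2 powr u * (2 powr u) ^ k)"
    by (rule mult_left_mono) simp
  then have "2 powr (- u) * D powr (- s) \<le> (2 powr u) ^ k"
    by (simp add: mult.assoc[symmetric] flip: powr_add)
  then have "exp (- pi) * (2 powr (- u) * D powr (- s)) \<le> exp (- pi * v\<^sup>2 / ((1/2) ^ k)\<^sup>2) * (2 powr u) ^ k"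
    by (intro mult_mono e) auto
  then have "ennreal (exp (- pi) * 2 powr (- u) * D powr (- s))
      \<le> ennreal ((2 powr u) ^ k * exp (- pi * v\<^sup>2 / ((1/2) ^ k)\<^sup>2))"
    by (intro ennreal_leI) (simp add: mult_ac)
  also have "\<dots> = (\<Sum>i\<in>{k}. ennreal ((2 powr u) ^ i * exp (- pi * v\<^sup>2 / ((1/2) ^ i)\<^sup>2)))"
    by (simp only: sum.insert_remove sum.empty finite.intros Diff_empty empty_Diff insert_Diff_single add_0_right)
  also have "\<dots> \<le> dyadic_kernel u v"
    unfolding dyadic_kernel_def by (rule sum_le_suminf) auto
  finally show ?thesis .
qed

lemma sum_energy_disjoint_le:
  fixes k :: "'a \<Rightarrow> 'a \<Rightarrow> ennreal"
  assumes M: "prob_space M" and W: "\<And>i::nat. W i \<in> sets M" "disjoint_family W"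
    and [measurable]: "case_prod k \<in> borel_measurable (M \<Otimes>\<^sub>M M)"
  shows "(\<Sum>i. \<integral>\<^sup>+x. \<integral>\<^sup>+y. indicator (W i) x * indicator (W i) y * k x y \<partial>M \<partial>M) \<le> (\<integral>\<^sup>+x. \<integral>\<^sup>+y. k x y \<partial>M \<partial>M)"
proof -
  interpret prob_space M by fact
  note W(1)[measurable]
  have "(\<Sum>i. \<integral>\<^sup>+x. \<integral>\<^sup>+y. indicator (W i) x * indicator (W i) y * k x y \<partial>M \<partial>M)
      = (\<integral>\<^sup>+x. (\<Sum>i. \<integral>\<^sup>+y. indicator (W i) x * indicator (W i) y * k x y \<partial>M) \<partial>M)"
    by (rule nn_integral_suminf[symmetric]) measurable
  also have "\<dots> = (\<integral>\<^sup>+x. \<integral>\<^sup>+y. (\<Sum>i. indicator (W i) x * indicator (W i) y * k x y) \<partial>M \<partial>M)"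
    by (intro nn_integral_cong nn_integral_suminf[symmetric]) measurable
  also have "\<dots> \<le> (\<integral>\<^sup>+x. \<integral>\<^sup>+y. k x y \<partial>M \<partial>M)"
  proof (intro nn_integral_mono)
    fix x y
    have "(\<Sum>i. indicator (W i) x * indicator (W i) y * k x y) \<le> (\<Sum>i. indicator (W i) x * k x y)"
      by (intro suminf_le) (auto split: split_indicator)
    also have "\<dots> = indicator (\<Union>i. W i) x * k x y"
      by (simp add: suminf_indicator[OF W(2)])
    also have "\<dots> \<le> k x y" by (auto split: split_indicator)
    finally show "(\<Sum>i. indicator (W i) x * indicator (W i) y * k x y) \<le> k x y" .
  qed
  finally show ?thesis .
qed

text \<open>
  The energy form of the mass distribution principle. Let a countable cover of \<open>A\<close> be given and let
  \<open>W i\<close> be disjoint preimages of its (closed) members, of masses \<open>m i\<close> and diameters \<open>D i\<close>. The kernel is at least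
  a multiple of \<open>D i powr (- s)\<close> on \<open>W i \<times> W i\<close>, so the energy \<open>J i\<close> of \<open>W i\<close> satisfies
  \<open>(m i)\<^sup>2 \<le> const * D i powr s * J i\<close>, whence \<open>2 m i \<le> const * \<eta> * D i powr s + J i / \<eta>\<close> for any
  \<open>\<eta> > 0\<close>. The masses add up to \<open>1\<close> and the energies to at most \<open>I\<close>; the choice \<open>\<eta> = I + 1\<close>
  keeps the energy term below \<open>1\<close> and bounds the sum of the \<open>D i powr s\<close> from below.

  The energy is measured by \<open>\<phi>\<close> and the covered set by \<open>f\<close>, to pass from squared
  distances to distances.
\<close>

lemma hausdorff_measure_pos_of_energy:
  fixes f \<phi> :: "'a \<Rightarrow> real"
  assumes M: "prob_space M"
    and meas [measurable]: "f \<in> borel_measurable M" "\<phi> \<in> borel_measurable M" "S \<in> sets M"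
    and AE_S: "AE y in M. y \<in> S" and fS: "f ` S \<subseteq> A"
    and lip: "\<And>y y'. y \<in> S \<Longrightarrow> y' \<in> S \<Longrightarrow> \<bar>\<phi> y - \<phi> y'\<bar> \<le> L * \<bar>f y - f y'\<bar>"
    and s: "0 \<le> s" "s \<le> u"
    and energy: "(\<integral>\<^sup>+y. \<integral>\<^sup>+y'. dyadic_kernel u (\<phi> y - \<phi> y') \<partial>M \<partial>M) < \<infinity>"
  shows "hausdorff_measure s A > 0"
proof -
  interpret prob_space M by fact
  have four_mult_le: "4 * a * b \<le> (a + b)\<^sup>2" for a b :: real
    using zero_le_power2[of "a - b"] by (simp add: power2_sum power2_diff)
  define L' where "L' = max L 1"
  have L': "L' \<ge> 1" by (simp add: L'_def)
  have lip': "\<bar>\<phi> y - \<phi> y'\<bar> \<le> L' * \<bar>f y - f y'\<bar>" if "y \<in> S" "y' \<in> S" for y y'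
    using lip[OF that] mult_right_mono[of L L' "\<bar>f y - f y'\<bar>"] by (simp add: L'_def)
  obtain I where I: "(\<integral>\<^sup>+y. \<integral>\<^sup>+y'. dyadic_kernel u (\<phi> y - \<phi> y') \<partial>M \<partial>M) = ennreal I" "I \<ge> 0"
    using energy by (cases "\<integral>\<^sup>+y. \<integral>\<^sup>+y'. dyadic_kernel u (\<phi> y - \<phi> y') \<partial>M \<partial>M") auto
  define c where "c = exp (- pi) * 2 powr (- u) * L' powr (- s)"
  define \<eta> where "\<eta> = I + 1"
  have c: "c > 0" and \<eta>: "\<eta> > 0" using L' I(2) by (auto simp: c_def \<eta>_def)
  define q where "q = \<eta> / c"
  have q: "q > 0" using c \<eta> by (simp add: q_def)
  have "ennreal (c / \<eta>) \<le> hausdorff_premeasure s (1 / L') A"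
    unfolding hausdorff_premeasure_def
  proof (rule Inf_greatest, clarify)
    fix U :: "nat \<Rightarrow> real set"
    assume cover: "A \<subseteq> (\<Union>i. U i)" and U: "\<forall>i. bounded (U i) \<and> diameter (U i) \<le> 1 / L'"
    \<comment> \<open>Closures make the preimages measurable and preserve the diameters.\<close>
    define V where "V i = S \<inter> (f -` closure (U i) \<inter> space M)" for i
    have [measurable]: "V i \<in> sets M" for i unfolding V_def by measurable
    define W where "W = disjointed V"
    have "range V \<subseteq> sets M" by auto
    then have "range W \<subseteq> sets M" unfolding W_def by (rule sets.range_disjointed_sets)
    then have Wm: "W i \<in> sets M" for i by auto
    note Wm[measurable]
    have Wd: "disjoint_family W" by (simp add: W_def disjoint_family_disjointed)
    have WV: "W i \<subseteq> V i" for i by (simp add: W_def disjointed_subset)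
    define J where "J i = (\<integral>\<^sup>+y. \<integral>\<^sup>+y'. indicator (W i) y * indicator (W i) y' * dyadic_kernel u (\<phi> y - \<phi> y') \<partial>M \<partial>M)" for i
    have J_sum: "(\<Sum>i. J i) \<le> ennreal I"
      unfolding J_def I(1)[symmetric] by (rule sum_energy_disjoint_le[OF M Wm Wd]) measurable
    have J_lower: "ennreal b * emeasure M (W i) ^ 2 \<le> J i"
      if "\<And>y y'. y \<in> W i \<Longrightarrow> y' \<in> W i \<Longrightarrow> ennreal b \<le> dyadic_kernel u (\<phi> y - \<phi> y')" for b i
    proof -
      have "ennreal b * emeasure M (W i) ^ 2
          = (\<integral>\<^sup>+y. \<integral>\<^sup>+y'. indicator (W i) y * indicator (W i) y' * ennreal b \<partial>M \<partial>M)"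
        by (simp add: nn_integral_cmult nn_integral_multc power2_eq_square mult_ac)
      also have "\<dots> \<le> J i"
        unfolding J_def by (intro nn_integral_mono) (auto split: split_indicator intro!: that)
      finally show ?thesis .
    qed
    have dist_W: "\<bar>\<phi> y - \<phi> y'\<bar> \<le> L' * diameter (U i)" if "y \<in> W i" "y' \<in> W i" for y y' i
    proof -
      have y: "y \<in> S" "y' \<in> S" "f y \<in> closure (U i)" "f y' \<in> closure (U i)"
        using that WV[of i] by (auto simp: V_def)
      have "\<bar>f y - f y'\<bar> \<le> diameter (U i)"
        using diameter_bounded_bound[of "closure (U i)" "f y" "f y'"] y U
        by (simp add: bounded_closure diameter_closure dist_real_def)
      then have "L' * \<bar>f y - f y'\<bar> \<le> L' * diameter (U i)" using L' by (intro mult_left_mono) auto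
      then show ?thesis using lip'[OF y(1,2)] by linarith
    qed
    have single: "2 * emeasure M (W i) \<le> ennreal q * diam_pow s (U i) + J i / ennreal \<eta>" for i
    proof (cases "emeasure M (W i) = 0")
      case False
      then obtain y where "y \<in> W i" by (metis emeasure_empty ex_in_conv)
      then have "U i \<noteq> {}" using WV[of i] by (auto simp: V_def)
      have "J i \<le> (\<Sum>i. J i)" using sum_le_suminf[of J "{i}"] by simp
      also note J_sum
      finally have "J i < \<infinity>" using le_less_trans[OF _ ennreal_less_top] by simp
      then obtain j where j: "J i = ennreal j" "j \<ge> 0" by (cases "J i") auto
      define m where "m = measure M (W i)"
      have m: "emeasure M (W i) = ennreal m" "m > 0"
        using False by (auto simp: m_def emeasure_eq_measure zero_less_measure_iff)
      let ?D = "diameter (U i)"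
      \<comment> \<open>On a set of diameter zero the kernel is infinite, so finite energy excludes positive mass.\<close>
      have "?D \<noteq> 0"
      proof
        assume "?D = 0"
        then have zero: "\<phi> y - \<phi> y' = 0" if "y \<in> W i" "y' \<in> W i" for y y'
          using dist_W[OF that] by simp
        have *: "ennreal b * emeasure M (W i) ^ 2 \<le> J i" for b
        proof (rule J_lower)
          fix y y' assume "y \<in> W i" "y' \<in> W i"
          then have "\<phi> y - \<phi> y' = 0" by (rule zero)
          then show "ennreal b \<le> dyadic_kernel u (\<phi> y - \<phi> y')"
            using s by (simp add: dyadic_kernel_0)
        qed
        define b where "b = (j + 1) / m\<^sup>2"
        have b: "b \<ge> 0" "b * m\<^sup>2 = j + 1" using m(2) j(2) by (auto simp: b_def)
        have "ennreal (b * m\<^sup>2) = ennreal b * emeasure M (W i) ^ 2"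
          using b(1) m by (simp only: ennreal_mult zero_le_power2 ennreal_power less_imp_le)
        also have "\<dots> \<le> ennreal j" using *[of b] j(1) by (simp only:)
        finally show False unfolding b(2) using j(2) by simp
      qed
      then have D: "0 < ?D" using U diameter_ge_0[of "U i"] by auto
      then have LD: "0 < L' * ?D" "L' * ?D \<le> 1"
        using L' U by (auto simp: pos_le_divide_eq mult.commute)
      have "ennreal (c * ?D powr (- s)) * emeasure M (W i) ^ 2 \<le> J i"
      proof (rule J_lower)
        fix y y' assume "y \<in> W i" "y' \<in> W i"
        then have "ennreal (exp (- pi) * 2 powr (- u) * (L' * ?D) powr (- s)) \<le> dyadic_kernel u (\<phi> y - \<phi> y')"
          using s LD dist_W by (intro dyadic_kernel_ge) auto
        then show "ennreal (c * ?D powr (- s)) \<le> dyadic_kernel u (\<phi> y - \<phi> y')"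
          using L' D by (simp add: c_def powr_mult mult_ac)
      qed
      then have "c * ?D powr (- s) * m\<^sup>2 \<le> j"
        using m j c by (simp add: ennreal_power flip: ennreal_mult)
      then have mj: "m\<^sup>2 \<le> (?D powr s / c) * j"
        using c D by (simp add: powr_minus field_simps)
      have "2 * m \<le> \<eta> * (?D powr s / c) + j / \<eta>"
      proof (rule power2_le_imp_le)
        have "(2 * m)\<^sup>2 \<le> 4 * (\<eta> * (?D powr s / c)) * (j / \<eta>)"
          using mj \<eta> by (simp add: power_mult_distrib)
        also have "\<dots> \<le> (\<eta> * (?D powr s / c) + j / \<eta>)\<^sup>2"
          by (rule four_mult_le)
        finally show "(2 * m)\<^sup>2 \<le> (\<eta> * (?D powr s / c) + j / \<eta>)\<^sup>2" .
        show "0 \<le> \<eta> * (?D powr s / c) + j / \<eta>" using \<eta> c j by simp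
      qed
      then have "ennreal (2 * m) \<le> ennreal (q * ?D powr s + j / \<eta>)"
        by (intro ennreal_leI) (simp add: q_def)
      moreover have "diam_pow s (U i) = ennreal (?D powr s)"
        using \<open>U i \<noteq> {}\<close> D by (auto simp: diam_pow_def)
      ultimately show ?thesis
        using m j \<eta> q by (simp add: ennreal_mult divide_ennreal)
    qed simp
    have "1 = emeasure M (\<Union>i. W i)"
    proof -
      have "emeasure M (\<Union>i. W i) = 1"
      proof (rule emeasure_eq_1_AE)
        show "(\<Union>i. W i) \<in> sets M" using Wm by blast
        have "y \<in> (\<Union>i. W i)" if "y \<in> S" for y
        proof -
          have "y \<in> space M" using that sets.sets_into_space[OF meas(3)] by auto
          moreover have "f y \<in> (\<Union>i. U i)" using that fS cover by auto
          then obtain i where "f y \<in> U i" ..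
          then have "f y \<in> closure (U i)" using closure_subset by auto
          ultimately have "y \<in> V i" using that by (simp add: V_def)
          then show ?thesis unfolding W_def UN_disjointed_eq by (rule UN_I[OF UNIV_I])
        qed
        then show "AE y in M. y \<in> (\<Union>i. W i)" using AE_S by (auto elim!: eventually_mono)
      qed
      then show ?thesis ..
    qed
    also have "\<dots> = (\<Sum>i. emeasure M (W i))"
      using Wm Wd by (intro suminf_emeasure[symmetric]) auto
    finally have one: "(\<Sum>i. emeasure M (W i)) = 1" ..
    have "2 = (\<Sum>i. 2 * emeasure M (W i))" by (simp add: one)
    also have "\<dots> \<le> (\<Sum>i. ennreal q * diam_pow s (U i) + J i / ennreal \<eta>)"
      by (intro suminf_le single) auto
    also have "\<dots> = ennreal q * (\<Sum>i. diam_pow s (U i)) + (\<Sum>i. J i) / ennreal \<eta>"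
      by (simp add: suminf_add[symmetric] divide_ennreal_def)
    also have "\<dots> \<le> ennreal q * (\<Sum>i. diam_pow s (U i)) + ennreal I / ennreal \<eta>"
      by (intro add_mono order.refl divide_right_mono_ennreal J_sum)
    also have "\<dots> \<le> ennreal q * (\<Sum>i. diam_pow s (U i)) + 1"
    proof (intro add_mono order.refl)
      have "ennreal I / ennreal \<eta> = ennreal (I / \<eta>)" using I(2) \<eta> by (rule divide_ennreal)
      also have "\<dots> \<le> 1" using I(2) by (simp add: \<eta>_def)
      finally show "ennreal I / ennreal \<eta> \<le> 1" .
    qed
    finally have two: "2 \<le> ennreal q * (\<Sum>i. diam_pow s (U i)) + 1" .
    show "ennreal (c / \<eta>) \<le> (\<Sum>i. diam_pow s (U i))"
    proof (cases "\<Sum>i. diam_pow s (U i)")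
      case (real \<sigma>)
      then have "ennreal 2 \<le> ennreal (q * \<sigma> + 1)"
        using two q by (simp add: ennreal_mult)
      then have "1 \<le> q * \<sigma>"
        using q real(1) by (subst (asm) ennreal_le_iff) auto
      then have "c / \<eta> \<le> \<sigma>"
        using \<eta> c by (simp add: q_def field_simps)
      then show ?thesis using real by (simp add: ennreal_leI)
    qed simp
  qed
  also have "\<dots> \<le> hausdorff_measure s A"
    unfolding hausdorff_measure_def using L' by (intro SUP_upper) auto
  finally show ?thesis using c \<eta> by (auto intro: less_le_trans[rotated])
qed

text \<open>
  By second countability the complement of the support is a countable union of null basic open
  sets.
\<close>

lemma AE_in_measure_supp:
  fixes M :: "'a::second_countable_topology measure"
  assumes sets: "sets M = sets borel"
  shows "AE x in M. x \<in> measure_supp M"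
proof -
  obtain B :: "'a set set" where B: "countable B" "topological_basis B"
    using ex_countable_basis by blast
  let ?N = "\<Union>U\<in>{U \<in> B. emeasure M U = 0}. U"
  have "?N \<in> null_sets M"
    using B topological_basis_open[OF B(2)]
    by (intro null_sets_UN') (auto simp: null_sets_def sets)
  then show ?thesis
  proof (rule AE_I', clarsimp simp: measure_supp_def)
    fix x U assume "open U" "x \<in> U" and U: "emeasure M U = 0"
    then obtain V where "V \<in> B" "x \<in> V" "V \<subseteq> U"
      using B(2) by (meson topological_basisE)
    moreover from this have "emeasure M V = 0"
      using emeasure_mono[of V U M] U \<open>open U\<close> by (simp add: sets)
    ultimately show "\<exists>V. V \<in> B \<and> emeasure M V = 0 \<and> x \<in> V" by blast
  qed
qed

lemma fourier_spectrum_nonneg: "0 \<le> fourier_spectrum \<theta> M"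
proof (cases "{s. 0 \<le> s \<and> fourier_energy s \<theta> M < \<infinity>} = {}")
  case False
  then obtain s where "0 \<le> s" "fourier_energy s \<theta> M < \<infinity>" by auto
  then have "ereal 0 \<le> fourier_spectrum \<theta> M"
    unfolding fourier_spectrum_def Let_def
    by (auto intro!: Sup_upper2[of "ereal s"])
  then show ?thesis by (simp only: zero_ereal_def)
qed (simp add: fourier_spectrum_def)

lemma exists_finite_energy_below_spectrum:
  assumes "ereal a < fourier_spectrum \<theta> M" "0 \<le> a"
  obtains s where "a < s" "ereal s \<le> fourier_spectrum \<theta> M" "fourier_energy_integral s \<theta> M < \<infinity>"
proof -
  let ?S = "{s. 0 \<le> s \<and> fourier_energy s \<theta> M < \<infinity>}"
  have "?S \<noteq> {}" using assms by (auto simp: fourier_spectrum_def split: if_splits)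
  then have eq: "fourier_spectrum \<theta> M = Sup (ereal ` ?S)" by (simp only: fourier_spectrum_def Let_def if_False)
  then obtain s where s: "s \<in> ?S" "a < s" using assms(1) by (auto simp: less_Sup_iff)
  show thesis
  proof (rule that[OF s(2)])
    show "ereal s \<le> fourier_spectrum \<theta> M" unfolding eq using s(1) by (intro Sup_upper) auto
    show "fourier_energy_integral s \<theta> M < \<infinity>"
      using s(1) by (auto simp: fourier_energy_def Let_def less_top split: if_splits)
  qed
qed

text \<open>
  Finiteness of the average energy gives finite energy for almost every pin, and
  \<open>y \<mapsto> |x - y|\<^sup>2\<close> is Lipschitz as a function of \<open>|x - y|\<close> on the bounded support of \<open>\<nu>\<close>. The quantifier
  over \<open>s\<close> stands inside the almost-everywhere statement, so that countably many \<open>u\<close> suffice for the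
  dimension.
\<close>

lemma AE_hausdorff_measure_pinned_distance_pos:
  fixes \<mu> \<nu> :: "'a::euclidean_space measure"
  assumes "borel_prob \<mu>" "borel_prob \<nu>" "compact (measure_supp \<mu>)" "compact (measure_supp \<nu>)"
    and s: "s\<^sub>1 \<le> real DIM('a) / 2" "s\<^sub>2 \<le> real DIM('a) / 2"
    and J: "fourier_energy_integral s\<^sub>1 (1/2) \<mu> < \<infinity>" "fourier_energy_integral s\<^sub>2 (1/2) \<nu> < \<infinity>"
    and u: "u < 1" "u < (s\<^sub>1 + s\<^sub>2) / 2 - real DIM('a) / 4"
  shows "AE x in \<mu>. \<forall>s. 0 \<le> s \<longrightarrow> s \<le> u \<longrightarrow>
           0 < hausdorff_measure s (pinned_distance_set x (measure_supp \<nu>))"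
proof -
  interpret \<mu>: borel_prob \<mu> by fact
  interpret \<nu>: borel_prob \<nu> by fact
  obtain R where R: "\<forall>x\<in>measure_supp \<mu> \<union> measure_supp \<nu>. norm x \<le> R"
    using assms(3,4) by (metis bounded_Un bounded_iff compact_imp_bounded)
  have AE_R: "AE x in \<mu>. norm x \<le> R" "AE y in \<nu>. norm y \<le> R"
    using AE_in_measure_supp[OF \<mu>.sets_eq_borel] AE_in_measure_supp[OF \<nu>.sets_eq_borel] R
    by (auto elim!: eventually_mono)
  have "(\<integral>\<^sup>+x. \<integral>\<^sup>+y. \<integral>\<^sup>+y'. dyadic_kernel u ((dist x y)\<^sup>2 - (dist x y')\<^sup>2) \<partial>\<nu> \<partial>\<nu> \<partial>\<mu>) \<noteq> \<infinity>"
    using mean_dyadic_energy_finite[OF assms(1,2) AE_R s J u] by simp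
  then have "AE x in \<mu>. (\<integral>\<^sup>+y. \<integral>\<^sup>+y'. dyadic_kernel u ((dist x y)\<^sup>2 - (dist x y')\<^sup>2) \<partial>\<nu> \<partial>\<nu>) \<noteq> \<infinity>"
    by (intro nn_integral_PInf_AE) measurable
  then show ?thesis
  proof eventually_elim
    case (elim x)
    show ?case
    proof (intro allI impI)
      fix s :: real assume s: "0 \<le> s" "s \<le> u"
      show "0 < hausdorff_measure s (pinned_distance_set x (measure_supp \<nu>))"
      proof (rule hausdorff_measure_pos_of_energy[where f = "dist x" and \<phi> = "\<lambda>y. (dist x y)\<^sup>2"
            and S = "measure_supp \<nu>" and M = \<nu> and L = "2 * (norm x + R)" and u = u])
        show "measure_supp \<nu> \<in> sets \<nu>" using assms(4) by (simp add: compact_imp_closed)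
        show "AE y in \<nu>. y \<in> measure_supp \<nu>" by (rule AE_in_measure_supp) simp
        show "dist x ` measure_supp \<nu> \<subseteq> pinned_distance_set x (measure_supp \<nu>)"
          by (auto simp: pinned_distance_set_def)
        fix y y' assume y: "y \<in> measure_supp \<nu>" "y' \<in> measure_supp \<nu>"
        have "dist x z \<le> norm x + R" if "z \<in> measure_supp \<nu>" for z
          using R that norm_triangle_ineq4[of x z] by (force simp: dist_norm)
        from this[OF y(1)] this[OF y(2)] have "dist x y + dist x y' \<le> 2 * (norm x + R)" by simp
        then have "(dist x y + dist x y') * \<bar>dist x y - dist x y'\<bar> \<le> 2 * (norm x + R) * \<bar>dist x y - dist x y'\<bar>"
          by (rule mult_right_mono) simp
        moreover have "\<bar>(dist x y)\<^sup>2 - (dist x y')\<^sup>2\<bar> = (dist x y + dist x y') * \<bar>dist x y - dist x y'\<bar>"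
          by (simp add: power2_eq_square square_diff_square_factored abs_mult)
        ultimately show "\<bar>(dist x y)\<^sup>2 - (dist x y')\<^sup>2\<bar> \<le> 2 * (norm x + R) * \<bar>dist x y - dist x y'\<bar>"
          by simp
      qed (use s elim \<nu>.prob_space_axioms in \<open>auto simp: less_top\<close>)
    qed
  qed
qed

theorem corollary2p3:
  fixes \<mu>\<^sub>1 \<mu>\<^sub>2 :: "(real ^ 'd) measure"
  assumes "CARD('d) \<ge> 2"
    and "prob_space \<mu>\<^sub>1" and "sets \<mu>\<^sub>1 = sets borel" and "compact (measure_supp \<mu>\<^sub>1)"
    and "prob_space \<mu>\<^sub>2" and "sets \<mu>\<^sub>2 = sets borel" and "compact (measure_supp \<mu>\<^sub>2)"
    and "fourier_spectrum (1/2) \<mu>\<^sub>1 \<le> ereal (real CARD('d) / 2)"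
    and "fourier_spectrum (1/2) \<mu>\<^sub>2 \<le> ereal (real CARD('d) / 2)"
  shows "AE x in \<mu>\<^sub>1.
           hausdorff_dim (pinned_distance_set x (measure_supp \<mu>\<^sub>2))
             \<ge> min 1 ((fourier_spectrum (1/2) \<mu>\<^sub>1 + fourier_spectrum (1/2) \<mu>\<^sub>2) / 2
                        - ereal (real CARD('d) / 4))"
proof -
  have bp: "borel_prob \<mu>\<^sub>1" "borel_prob \<mu>\<^sub>2"
    using assms by (auto simp: borel_prob_def borel_prob_axioms_def)
  let ?d = "real CARD('d)"
  let ?H = "\<lambda>s x. hausdorff_measure s (pinned_distance_set x (measure_supp \<mu>\<^sub>2))"
  obtain f\<^sub>1 where f\<^sub>1: "fourier_spectrum (1/2) \<mu>\<^sub>1 = ereal f\<^sub>1" "0 \<le> f\<^sub>1" "f\<^sub>1 \<le> ?d / 2"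
    using assms(8) fourier_spectrum_nonneg[of "1/2" \<mu>\<^sub>1] by (cases "fourier_spectrum (1/2) \<mu>\<^sub>1") auto
  obtain f\<^sub>2 where f\<^sub>2: "fourier_spectrum (1/2) \<mu>\<^sub>2 = ereal f\<^sub>2" "0 \<le> f\<^sub>2" "f\<^sub>2 \<le> ?d / 2"
    using assms(9) fourier_spectrum_nonneg[of "1/2" \<mu>\<^sub>2] by (cases "fourier_spectrum (1/2) \<mu>\<^sub>2") auto
  define T where "T = min 1 ((f\<^sub>1 + f\<^sub>2) / 2 - ?d / 4)"
  have T: "min 1 ((fourier_spectrum (1/2) \<mu>\<^sub>1 + fourier_spectrum (1/2) \<mu>\<^sub>2) / 2 - ereal (?d / 4)) = ereal T"
    by (simp add: f\<^sub>1 f\<^sub>2 T_def min_def one_ereal_def)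
  have "AE x in \<mu>\<^sub>1. \<forall>s. 0 \<le> s \<longrightarrow> s \<le> u \<longrightarrow> 0 < ?H s x" if u: "0 \<le> u" "u < T" for u
  proof -
    define \<delta> where "\<delta> = (f\<^sub>1 + f\<^sub>2) / 2 - ?d / 4 - u"
    have \<delta>: "\<delta> > 0" "u < 1" using u by (auto simp: \<delta>_def T_def)
    \<comment> \<open>Both spectra are positive: if one vanished, the other could not exceed \<open>d/2\<close> as \<open>u \<ge> 0\<close> demands.\<close>
    have pos: "f\<^sub>1 > 0" "f\<^sub>2 > 0" using \<delta>(1) u f\<^sub>1 f\<^sub>2 by (auto simp: \<delta>_def field_simps)
    obtain s\<^sub>1 where s\<^sub>1: "max 0 (f\<^sub>1 - \<delta>) < s\<^sub>1" "ereal s\<^sub>1 \<le> ereal f\<^sub>1" "fourier_energy_integral s\<^sub>1 (1/2) \<mu>\<^sub>1 < \<infinity>"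
      using exists_finite_energy_below_spectrum[of "max 0 (f\<^sub>1 - \<delta>)" "1/2" \<mu>\<^sub>1] f\<^sub>1 pos \<delta> by auto
    obtain s\<^sub>2 where s\<^sub>2: "max 0 (f\<^sub>2 - \<delta>) < s\<^sub>2" "ereal s\<^sub>2 \<le> ereal f\<^sub>2" "fourier_energy_integral s\<^sub>2 (1/2) \<mu>\<^sub>2 < \<infinity>"
      using exists_finite_energy_below_spectrum[of "max 0 (f\<^sub>2 - \<delta>)" "1/2" \<mu>\<^sub>2] f\<^sub>2 pos \<delta> by auto
    show ?thesis
    proof (rule AE_hausdorff_measure_pinned_distance_pos[OF bp assms(4,7) _ _ s\<^sub>1(3) s\<^sub>2(3)])
      show "u < (s\<^sub>1 + s\<^sub>2) / 2 - real DIM(real^'d) / 4"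
        using s\<^sub>1(1) s\<^sub>2(1) by (simp add: \<delta>_def field_simps)
    qed (use s\<^sub>1 s\<^sub>2 f\<^sub>1 f\<^sub>2 \<delta> in auto)
  qed
  then have "AE x in \<mu>\<^sub>1. \<forall>u\<in>{u \<in> \<rat>. 0 \<le> u \<and> u < T}. \<forall>s. 0 \<le> s \<longrightarrow> s \<le> u \<longrightarrow> 0 < ?H s x"
    by (subst AE_ball_countable) (auto intro: countable_subset[OF _ countable_rat])
  then show ?thesis
    unfolding T
  proof eventually_elim
    case (elim x)
    show "ereal T \<le> hausdorff_dim (pinned_distance_set x (measure_supp \<mu>\<^sub>2))"
      unfolding hausdorff_dim_def
    proof (rule Inf_greatest, clarify)
      fix s assume s: "0 \<le> s" "?H s x = 0"
      show "ereal T \<le> ereal s"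
      proof (rule ccontr)
        assume "\<not> ereal T \<le> ereal s"
        then obtain u where "u \<in> \<rat>" "s < u" "u < T" using Rats_dense_in_real[of s T] by auto
        then show False using elim s by force
      qed
    qed
  qed
qed

end
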